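(* Let $G=(V,E)$ be a finite undirected graph, let $C_i\subset\mathbb{R}^m$ ($i\in V$) be closed convex sets, and let $\bar x\in\mathbb{R}^m$ (together with the associated optimal point $x^*$) be such that the problem assumptions (A1)–(A8) listed in the context hold. Let $\{\mathbf{z}_\alpha^{n,w}\}_{\alpha\in V\cup E}$, $n\ge 1$, $0\le w\le\bar w$, be generated by the distributed Dykstra's algorithm described in the context, with index sets $S_{n,w}$ satisfying the algorithmic assumptions (B1)–(B2) listed in the context. Write $\mathbf{z}^{n,w}=\{\mathbf{z}^{n,w}_\alpha\}_{\alpha\in V\cup E}$, $\mathbf{x}^{n,w}=\bar{\mathbf{x}}-\sum_{\alpha\in V\cup E}\mathbf{z}_\alpha^{n,w}$, and let $x_i^{n,w}\in\mathbb{R}^m$ be the $i$-th component of $\mathbf{x}^{n,w}$. Let $F$ be the dual function defined in the context. Then there is a constant $r\in(0,1)$ such that, for all sufficiently large $n$, $$F(\mathbf{z}^{n+1,0})\le r\,F(\mathbf{z}^{n-1,0}).$$ Consequently, for every $i\in V$, the sequence $\{\|x_i^{n,0}-x^*\|\}_{n\ge1}$ converges linearly to zero, i.e. there are constants $K>0$ and $\rho\in(0,1)$ such that $\|x_i^{n,0}-x^*\|\le K\rho^n$ for all $n\ge 1$.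
   Context: **Notation.** All norms are Euclidean. $d(\cdot,S)$ is the distance to the set $S$. For a closed convex set $C$: $\delta_C$ is its indicator function ($0$ on $C$, $+\infty$ off $C$); $\delta_C^*(z)=\sup_{x\in C}\langle z,x\rangle$ is the Fenchel conjugate of $\delta_C$; $N_C(x)$ is the normal cone to $C$ at $x\in C$; $\partial C$ is its boundary. Elements of $[\mathbb{R}^m]^{|V|}$ are written in bold, and $[\mathbf{x}]_i\in\mathbb{R}^m$ is the component of $\mathbf{x}$ indexed by $i\in V$. **Setting.** The problem is to minimize $\sum_{i\in V}\left[\delta_{C_i}(x)+\frac12\|x-\bar x_i\|^2\right]$ over $x\in\mathbb{R}^m$, where the points $\bar x_i\in\mathbb{R}^m$ are all equal to a common $\bar x$ (assumption (A2)). Its optimal solution is denoted $x^*$; thus $x^*$ is the projection of $\bar x$ onto $\bigcap_{i\in V}C_i$. Let $\bar{\mathbf{x}}\in[\mathbb{R}^m]^{|V|}$ have all components equal to $\bar x$. For $i\in V$ let $\mathbf{f}_i(\mathbf{x})=\delta_{C_i}([\mathbf{x}]_i)$. For $e=(i,j)\in E$ let $H_e=\{\mathbf{x}\in[\mathbb{R}^m]^{|V|}:[\mathbf{x}]_i=[\mathbf{x}]_j\}$ and $\mathbf{f}_e=\delta_{H_e}$. Then $\mathbf{f}_e^*=\delta_{H_e}^*=\delta_{H_e^\perp}$, where $H_{(i,j)}^\perp$ consists of the $\mathbf{z}$ with $[\mathbf{z}]_i+[\mathbf{z}]_j=0$ and $[\mathbf{z}]_k=0$ for $k\ne i,j$.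 Dual variables are $\mathbf{z}=\{\mathbf{z}_\alpha\}_{\alpha\in V\cup E}$ with $\mathbf{z}_\alpha\in[\mathbb{R}^m]^{|V|}$. For $i\in V$, $\mathbf{z}_i$ has $[\mathbf{z}_i]_j=0$ for $j\ne i$, and we write $z_i=[\mathbf{z}_i]_i\in\mathbb{R}^m$. The dual function (to be minimized) is $$F(\mathbf{z})=\sum_{i\in V}\delta_{C_i}^*(z_i)+\sum_{e\in E}\delta_{H_e}^*(\mathbf{z}_e)+\frac12\Big\|\bar{\mathbf{x}}-\sum_{\alpha\in V\cup E}\mathbf{z}_\alpha\Big\|^2 .$$ **Distributed Dykstra's algorithm.** Fix a positive integer $\bar w$. Start with $\mathbf{z}_i^{1,0}$ ($i\in V$) such that $[\mathbf{z}_i^{1,0}]_j=0$ for all $j\neq i$, and $\mathbf{z}_{e}^{1,0}\in H_e^\perp$ for each $e\in E$. For $n=1,2,\dots$: for $w=1,\dots,\bar w$, choose a nonempty set $S_{n,w}\subset V\cup E$, let $$\{\mathbf{z}_\alpha^{n,w}\}_{\alpha\in S_{n,w}}\in\arg\min_{\mathbf{z}_\alpha,\ \alpha\in S_{n,w}}\ \frac12\Big\|\bar{\mathbf{x}}-\sum_{\alpha\notin S_{n,w}}\mathbf{z}_\alpha^{n,w-1}-\sum_{\alpha\in S_{n,w}}\mathbf{z}_\alpha\Big\|^2+\sum_{\alpha\in S_{n,w}}\mathbf{f}_\alpha^*(\mathbf{z}_\alpha),$$ (the minimizers are taken to exist) and set $\mathbf{z}_\alpha^{n,w}=\mathbf{z}_\alpha^{n,w-1}$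 for $\alpha\notin S_{n,w}$. After the inner loop set $\mathbf{z}_\alpha^{n+1,0}=\mathbf{z}_\alpha^{n,\bar w}$ for all $\alpha\in V\cup E$. **Problem assumptions.** (A1) $x^*=0$. (A2) The points $\bar x_i$ are all equal, to $\bar x$. (A3) (Existence of dual minimizers) There exist $z_i\in N_{C_i}(x^* )$, $i\in V$, with $\sum_{i\in V}z_i=|V|\bar x$. (A4) (Regularity of the sets) There are a neighborhood $U$ of $x^*$ and constants $M_{\max}>1$, $M_{\min}>0$, $\kappa_1>0$ such that whenever $x_i\in U$ and $z_i\in N_{C_i}(x_i)$ for all $i\in V$, and $[\bar{\mathbf{x}}-\sum_{\alpha\in V\cup E}\mathbf{z}_\alpha]_j\in U$ for all $j\in V$ (where $\mathbf{z}_i$ has $i$-th component $z_i$ and other components $0$, and $\mathbf{z}_e\in H_e^\perp$ for $e\in E$), then $M_{\min}\le\|z_i\|\le M_{\max}$ for all $i\in V$; moreover, for the hyperplanes $H_i=\{x:z_i^T(x-x_i)=0\}$, one has $d(x,\bigcap_{i\in V}H_i)\le\kappa_1\max_{i\in V}d(x,H_i)$ for all $x\in\mathbb{R}^m$. (A5) The graph $G$ is connected. (A6) (Semismoothness of order 2 at $x^*$) There are a neighborhood of $x^*$ and a constant $\kappa_2>0$ such that for every $i\in V$, every $x_i\in\partial C_i$ in this neighborhood, and every nonzero $z_i\in N_{C_i}(x_i)$, the supporting hyperplane $H_i=\{x:z_i^T(x-x_i)=0\}$ satisfies $d(x^*,H_i)\le\kappa_2\|x_i-x^*\|^2$. (Hence,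 as $x^*=0$, $\delta^*_{C_i}(z_i)=\langle z_i,x_i\rangle\le\kappa_2\|z_i\|\|x_i\|^2$.) (A7) (First order property on normals) There are a neighborhood $U$ of $x^*$ and $\kappa_3>0$ such that for all $i\in V$, $x\in U\cap C_i$ and $z\in N_{C_i}(x)\setminus\{0\}$, there is $z^r\in N_{C_i}(x^* )\setminus\{0\}$ with $\left\|\frac{z}{\|z\|}-\frac{z^r}{\|z^r\|}\right\|\le\kappa_3\|x-x^*\|$. (A8) (Linear regularity of normal cones) Let $M_1=\prod_{i\in V}N_{C_i}(x^* )$ and $M_2=\{(z_i)_{i\in V}\in[\mathbb{R}^m]^{|V|}:\sum_{i\in V}z_i=|V|\bar x\}$. There is $\kappa_4>0$ such that $d(\mathbf{z},M_1\cap M_2)\le\kappa_4\,d(\mathbf{z},M_2)$ for all $\mathbf{z}\in M_1$. **Algorithmic assumptions.** (B1) For all $\alpha\in V\cup E$ and $n\ge1$ there is $w_{n,\alpha}\in\{1,\dots,\bar w\}$ with $\alpha\in S_{n,w_{n,\alpha}}$. (B2) $S_{n,1}=V$ for all $n\ge1$. *)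

theory Defs
  imports "HOL-Analysis.Analysis"
begin

text \<open>
  The vertex set is the finite type \<open>'v\<close>; an edge is a two-element set of vertices.
  The space $[R^m]^{|V|}$ is \<open>real ^ 'm ^ 'v\<close>, whose norm is the Euclidean one.
  Families indexed by $V \cup E$ are functions on \<open>'v + 'v set\<close>; only their values on
  \<open>dual_index E\<close> matter.
\<close>

definition connected_graph :: "'v set set \<Rightarrow> bool" where
  "connected_graph E \<longleftrightarrow> (\<forall>u v. (u, v) \<in> {(i, j). {i, j} \<in> E}\<^sup>*)"

definition dual_index :: "'v set set \<Rightarrow> ('v + 'v set) set" where
  "dual_index E = UNIV <+> E"

definition convex_indicator :: "'a set \<Rightarrow> 'a \<Rightarrow> ereal" where
  "convex_indicator S x = (if x \<in> S then 0 else \<infinity>)"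

definition fenchel_conj :: "('a::real_inner \<Rightarrow> ereal) \<Rightarrow> 'a \<Rightarrow> ereal" where
  "fenchel_conj f z = (SUP x. ereal (z \<bullet> x) - f x)"

text \<open>The normal cone at a point outside \<open>S\<close> is empty, so \<open>z \<in> normal_cone S x\<close>
  entails \<open>x \<in> S\<close>.\<close>

definition normal_cone :: "'a::real_inner set \<Rightarrow> 'a \<Rightarrow> 'a set" where
  "normal_cone S x = {z. x \<in> S \<and> (\<forall>y\<in>S. z \<bullet> (y - x) \<le> 0)}"

definition normal_hyperplane :: "'a::real_inner \<Rightarrow> 'a \<Rightarrow> 'a set" where
  "normal_hyperplane z p = {x. z \<bullet> (x - p) = 0}"

definition primal_objective ::
  "('v::finite \<Rightarrow> (real ^ 'm) set) \<Rightarrow> ('v \<Rightarrow> real ^ 'm) \<Rightarrow> real ^ 'm \<Rightarrow> ereal" where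
  "primal_objective C xb x =
     (\<Sum>i\<in>UNIV. convex_indicator (C i) x + ereal (1 / 2 * (norm (x - xb i))\<^sup>2))"

text \<open>An optimal solution has finite value: if the sets \<open>C i\<close> had no common point, the
  objective would be identically \<open>\<infinity>\<close> and every point would minimize it.\<close>

definition primal_solution ::
  "('v::finite \<Rightarrow> (real ^ 'm) set) \<Rightarrow> ('v \<Rightarrow> real ^ 'm) \<Rightarrow> real ^ 'm \<Rightarrow> bool" where
  "primal_solution C xb x \<longleftrightarrow>
     primal_objective C xb x < \<infinity> \<and> is_arg_min (primal_objective C xb) (\<lambda>_. True) x"

definition edge_space :: "'v set \<Rightarrow> (real ^ 'm ^ 'v::finite) set" where
  "edge_space e = {x. \<forall>i\<in>e. \<forall>j\<in>e. x $ i = x $ j}"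

fun component_fun ::
  "('v::finite \<Rightarrow> (real ^ 'm) set) \<Rightarrow> 'v + 'v set \<Rightarrow> real ^ 'm ^ 'v \<Rightarrow> ereal" where
  "component_fun C (Inl i) x = convex_indicator (C i) (x $ i)"
| "component_fun C (Inr e) x = convex_indicator (edge_space e) x"

definition primal_point ::
  "'v set set \<Rightarrow> real ^ 'm \<Rightarrow> ('v + 'v set \<Rightarrow> real ^ 'm ^ 'v::finite) \<Rightarrow> real ^ 'm ^ 'v" where
  "primal_point E xbar z = (\<chi> i. xbar) - (\<Sum>\<alpha>\<in>dual_index E. z \<alpha>)"

definition dual_fun ::
  "'v set set \<Rightarrow> ('v::finite \<Rightarrow> (real ^ 'm) set) \<Rightarrow> real ^ 'm \<Rightarrow>
     ('v + 'v set \<Rightarrow> real ^ 'm ^ 'v) \<Rightarrow> ereal" where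
  "dual_fun E C xbar z =
     (\<Sum>i\<in>UNIV. fenchel_conj (convex_indicator (C i)) (z (Inl i) $ i))
     + (\<Sum>e\<in>E. fenchel_conj (convex_indicator (edge_space e)) (z (Inr e)))
     + ereal (1 / 2 * (norm (primal_point E xbar z))\<^sup>2)"

text \<open>Objective of the block subproblem: the blocks outside \<open>S\<close> are frozen at their values
  in \<open>zold\<close>; the blocks of \<open>y\<close> outside \<open>S\<close> do not enter.\<close>

definition block_objective ::
  "'v set set \<Rightarrow> ('v::finite \<Rightarrow> (real ^ 'm) set) \<Rightarrow> real ^ 'm \<Rightarrow> ('v + 'v set) set \<Rightarrow>
     ('v + 'v set \<Rightarrow> real ^ 'm ^ 'v) \<Rightarrow> ('v + 'v set \<Rightarrow> real ^ 'm ^ 'v) \<Rightarrow> ereal" where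
  "block_objective E C xbar S zold y =
     ereal (1 / 2 * (norm ((\<chi> i. xbar) - (\<Sum>\<alpha>\<in>dual_index E - S. zold \<alpha>) - (\<Sum>\<alpha>\<in>S. y \<alpha>)))\<^sup>2)
     + (\<Sum>\<alpha>\<in>S. fenchel_conj (component_fun C \<alpha>) (y \<alpha>))"

text \<open>\<open>z n w \<alpha>\<close> and \<open>S n w\<close> are only constrained for \<open>n \<ge> 1\<close>.\<close>

definition distributed_dykstra ::
  "'v set set \<Rightarrow> ('v::finite \<Rightarrow> (real ^ 'm) set) \<Rightarrow> real ^ 'm \<Rightarrow> nat \<Rightarrow>
     (nat \<Rightarrow> nat \<Rightarrow> ('v + 'v set) set) \<Rightarrow>
     (nat \<Rightarrow> nat \<Rightarrow> 'v + 'v set \<Rightarrow> real ^ 'm ^ 'v) \<Rightarrow> bool" where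
  "distributed_dykstra E C xbar wbar S z \<longleftrightarrow>
     (\<forall>i j. j \<noteq> i \<longrightarrow> z 1 0 (Inl i) $ j = 0) \<and>
     (\<forall>e\<in>E. z 1 0 (Inr e) \<in> orthogonal_comp (edge_space e)) \<and>
     (\<forall>n\<ge>1. \<forall>w\<in>{1..wbar}.
        S n w \<noteq> {} \<and> S n w \<subseteq> dual_index E \<and>
        is_arg_min (block_objective E C xbar (S n w) (z n (w - 1))) (\<lambda>_. True) (z n w) \<and>
        (\<forall>\<alpha>\<in>dual_index E - S n w. z n w \<alpha> = z n (w - 1) \<alpha>)) \<and>
     (\<forall>n\<ge>1. \<forall>\<alpha>\<in>dual_index E. z (Suc n) 0 \<alpha> = z n wbar \<alpha>)"

text \<open>\<open>infdist x {} = 0\<close> in the library, whereas the distance to the empty set is $+\infty$ in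
  the inequality below; hence the explicit nonemptiness of the intersection.\<close>

definition sets_regular ::
  "'v set set \<Rightarrow> ('v::finite \<Rightarrow> (real ^ 'm) set) \<Rightarrow> real ^ 'm \<Rightarrow> real ^ 'm \<Rightarrow> bool" where
  "sets_regular E C xbar xs \<longleftrightarrow>
     (\<exists>U Mmax Mmin \<kappa>. open U \<and> xs \<in> U \<and> 1 < Mmax \<and> 0 < Mmin \<and> 0 < \<kappa> \<and>
       (\<forall>x \<zeta> z.
          (\<forall>i. x i \<in> U \<and> \<zeta> i \<in> normal_cone (C i) (x i)) \<and>
          (\<forall>i. z (Inl i) = axis i (\<zeta> i)) \<and>
          (\<forall>e\<in>E. z (Inr e) \<in> orthogonal_comp (edge_space e)) \<and>
          (\<forall>j. primal_point E xbar z $ j \<in> U) \<longrightarrow>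
          (\<forall>i. Mmin \<le> norm (\<zeta> i) \<and> norm (\<zeta> i) \<le> Mmax) \<and>
          (\<Inter>i. normal_hyperplane (\<zeta> i) (x i)) \<noteq> {} \<and>
          (\<forall>y. infdist y (\<Inter>i. normal_hyperplane (\<zeta> i) (x i))
                 \<le> \<kappa> * (MAX i. infdist y (normal_hyperplane (\<zeta> i) (x i))))))"

definition semismooth_order2 :: "('v \<Rightarrow> (real ^ 'm) set) \<Rightarrow> real ^ 'm \<Rightarrow> bool" where
  "semismooth_order2 C xs \<longleftrightarrow>
     (\<exists>U \<kappa>. open U \<and> xs \<in> U \<and> 0 < \<kappa> \<and>
       (\<forall>i. \<forall>x \<in> frontier (C i) \<inter> U. \<forall>z \<in> normal_cone (C i) x - {0}.
          infdist xs (normal_hyperplane z x) \<le> \<kappa> * (norm (x - xs))\<^sup>2))"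

definition first_order_normals :: "('v \<Rightarrow> (real ^ 'm) set) \<Rightarrow> real ^ 'm \<Rightarrow> bool" where
  "first_order_normals C xs \<longleftrightarrow>
     (\<exists>U \<kappa>. open U \<and> xs \<in> U \<and> 0 < \<kappa> \<and>
       (\<forall>i. \<forall>x \<in> U \<inter> C i. \<forall>z \<in> normal_cone (C i) x - {0}.
          \<exists>zr \<in> normal_cone (C i) xs - {0}.
            norm (z /\<^sub>R norm z - zr /\<^sub>R norm zr) \<le> \<kappa> * norm (x - xs)))"

definition normal_product :: "('v::finite \<Rightarrow> (real ^ 'm) set) \<Rightarrow> real ^ 'm \<Rightarrow> (real ^ 'm ^ 'v) set" where
  "normal_product C xs = {z. \<forall>i. z $ i \<in> normal_cone (C i) xs}"

definition sum_constraint :: "real ^ 'm \<Rightarrow> (real ^ 'm ^ 'v::finite) set" where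
  "sum_constraint xbar = {z. (\<Sum>i\<in>UNIV. z $ i) = real CARD('v) *\<^sub>R xbar}"

text \<open>The intersection below is nonempty by the existence of dual minimizers, a separate
  hypothesis, so \<open>infdist\<close> is the usual distance here.\<close>

definition normal_cones_regular ::
  "('v::finite \<Rightarrow> (real ^ 'm) set) \<Rightarrow> real ^ 'm \<Rightarrow> real ^ 'm \<Rightarrow> bool" where
  "normal_cones_regular C xbar xs \<longleftrightarrow>
     (\<exists>\<kappa>>0. \<forall>z \<in> normal_product C xs.
        infdist z (normal_product C xs \<inter> sum_constraint xbar)
          \<le> \<kappa> * infdist z (sum_constraint xbar))"

end

theory Submission
  imports Defs
begin

text \<open>
  Write a dual point as a vector \<open>\<zeta>\<close> of vertex duals, the sum \<open>y\<close> of the edge duals, whose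
  components add up to zero, and the primal point \<open>x\<close>, so that \<open>\<zeta> + x + y\<close> is the vector with
  all components \<open>xbar\<close>. The dual optimal vertex duals are exactly the points \<open>\<zeta>\<^sup>*\<close> of
  \<open>normal_product C 0 \<inter> sum_constraint xbar\<close>, and the optimal dual value is \<open>0\<close>.

  Each block minimization decreases the dual function by at least half the squared change
  of \<open>x\<close> (\<open>block_minimizer_three_point\<close>). Within a cycle every edge forces the two components
  at its ends to agree at some step, and the graph is connected. Hence the distance \<open>d\<close> of \<open>x\<close>
  from a vector with equal components, taken right after the vertex step of the cycle,
  satisfies \<open>d\<^sup>2 \<le> L * D\<close>, where \<open>D\<close> is the decrease of the dual function over the rest of the
  cycle (\<open>consensus_error\<close>).

  Conversely, right after the vertex step the dual value is \<open>\<zeta> \<bullet> x + \<parallel>x\<parallel>\<^sup>2 / 2\<close>, and since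
  \<open>\<zeta>\<^sup>* \<bullet> x \<le> 0\<close> and \<open>\<zeta> - \<zeta>\<^sup>* + x\<close> is orthogonal to vectors with equal components,
  \<open>\<zeta> \<bullet> x + \<parallel>x\<parallel>\<^sup>2 \<le> \<parallel>\<zeta> - \<zeta>\<^sup>* + x\<parallel> * d\<close> (\<open>duality_gap_bound\<close>). This inequality is used twice.

  \<^item> The set of dual optima is bounded, hence so are the sublevel sets of the dual function
    (\<open>dual_level_set_bounded\<close>) and the iterates \<open>\<zeta>\<close>. With a fixed \<open>\<zeta>\<^sup>*\<close> the right-hand side is
    at most a constant times \<open>d\<close>, which tends to zero because the decreases \<open>D\<close> are summable.
    So \<open>x\<close> tends to zero.

  \<^item> Once \<open>x\<close> is small, the first order property of normals and the linear regularity of the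
    normal cones give a \<open>\<zeta>\<^sup>*\<close> with \<open>\<parallel>\<zeta> - \<zeta>\<^sup>*\<parallel> \<le> \<kappa> * \<parallel>x\<parallel>\<close> (\<open>dual_error_bound\<close>). Since
    \<open>\<zeta> \<bullet> x \<ge> 0\<close>, the inequality now yields \<open>\<parallel>x\<parallel> \<le> (\<kappa> + 1) * d\<close>, and then bounds the dual value
    by \<open>(\<kappa> + 1)\<^sup>2 * d\<^sup>2 \<le> K * D\<close> (\<open>dual_value_quadratic_bound\<close>).

  A value that is bounded by a constant times its own next decrease contracts by the factor
  \<open>K / (1 + K)\<close>. The dual value dominates \<open>\<parallel>x\<parallel>\<^sup>2 / 2\<close>, so \<open>x\<close> converges linearly as well.
\<close>

section \<open>Support functions\<close>

abbreviation support_fun :: "'a::real_inner set \<Rightarrow> 'a \<Rightarrow> ereal" where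
  "support_fun S \<equiv> fenchel_conj (convex_indicator S)"

lemma support_fun_le_iff:
  "support_fun S z \<le> ereal c \<longleftrightarrow> (\<forall>x\<in>S. z \<bullet> x \<le> c)"
  by (auto simp: fenchel_conj_def convex_indicator_def SUP_le_iff)

lemma inner_le_support_fun: "x \<in> S \<Longrightarrow> ereal (z \<bullet> x) \<le> support_fun S z"
  unfolding fenchel_conj_def by (rule SUP_upper2[of x]) (auto simp: convex_indicator_def)

lemma support_fun_nonneg: "0 \<in> S \<Longrightarrow> 0 \<le> support_fun S z"
  using inner_le_support_fun[of 0 S z] by (simp add: zero_ereal_def)

lemma support_fun_zero: "0 \<in> S \<Longrightarrow> support_fun S 0 = 0"
  using support_fun_le_iff[of S 0 0] support_fun_nonneg[of S 0]
  by (simp add: zero_ereal_def)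

lemma support_fun_finite:
  assumes "0 \<in> S" "support_fun S z \<noteq> \<infinity>"
  obtains a where "support_fun S z = ereal a" "0 \<le> a"
  using assms that support_fun_nonneg[of S z] by (cases "support_fun S z") auto

lemma support_fun_convex:
  assumes "support_fun S u = ereal a" "support_fun S v = ereal b" "0 \<le> t" "t \<le> 1"
  shows "support_fun S ((1 - t) *\<^sub>R u + t *\<^sub>R v) \<le> ereal ((1 - t) * a + t * b)"
  unfolding support_fun_le_iff
proof
  fix x assume x: "x \<in> S"
  have "u \<bullet> x \<le> a" "v \<bullet> x \<le> b"
    using inner_le_support_fun[OF x, of u] inner_le_support_fun[OF x, of v] assms by auto
  then have "(1 - t) * (u \<bullet> x) + t * (v \<bullet> x) \<le> (1 - t) * a + t * b"
    using assms by (intro add_mono mult_left_mono) auto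
  then show "((1 - t) *\<^sub>R u + t *\<^sub>R v) \<bullet> x \<le> (1 - t) * a + t * b"
    by (simp add: inner_add_left)
qed

text \<open>
  On a line the linear functional \<open>z\<close> is bounded above only if it vanishes there. This is how
  finiteness of the dual value keeps every edge dual in the orthogonal complement of its
  edge space.
\<close>

lemma support_fun_subspace_orthogonal:
  assumes "subspace S" "support_fun S z \<noteq> \<infinity>" "x \<in> S"
  shows "z \<bullet> x = 0"
proof (rule ccontr)
  assume nz: "z \<bullet> x \<noteq> 0"
  obtain a where a: "support_fun S z = ereal a"
    using support_fun_finite[OF subspace_0[OF assms(1)] assms(2)] by metis
  have "((a + 1) / (z \<bullet> x)) *\<^sub>R x \<in> S" using assms by (simp add: subspace_scale)
  from inner_le_support_fun[OF this, of z] a nz show False by simp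
qed

lemma support_fun_orthogonal:
  assumes "0 \<in> S" "\<And>x. x \<in> S \<Longrightarrow> z \<bullet> x = 0"
  shows "support_fun S z = 0"
  using support_fun_le_iff[of S z 0] support_fun_nonneg[of S z] assms
  by (simp add: zero_ereal_def)

text \<open>
  The inversion of subgradients between a support function and its indicator function. A
  point outside \<open>S\<close> would violate the subgradient inequality in the direction \<open>u = - p\<close> of a
  separating functional; the choice \<open>u = - z\<close> shows that \<open>z\<close> attains its supremum over \<open>S\<close>
  at \<open>x\<close>.
\<close>

lemma normal_cone_if_subgradient_of_support_fun:
  fixes S :: "'a::euclidean_space set"
  assumes S: "closed S" "convex S" "0 \<in> S"
    and fin: "support_fun S z \<noteq> \<infinity>"
    and sub: "\<And>u. support_fun S z + ereal (x \<bullet> u) \<le> support_fun S (z + u)"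
  shows "z \<in> normal_cone S x"
proof -
  obtain a where a: "support_fun S z = ereal a"
    using support_fun_finite[OF S(3) fin] by metis
  have za: "z \<bullet> y \<le> a" if "y \<in> S" for y
    using inner_le_support_fun[OF that, of z] a by simp
  have "x \<in> S"
  proof (rule ccontr)
    assume "x \<notin> S"
    then obtain p b where p: "p \<bullet> x < b" "\<forall>y\<in>S. b < p \<bullet> y"
      using separating_hyperplane_closed_point[OF S(2,1)] by metis
    have "support_fun S (z + - p) \<le> ereal (a - b)"
      unfolding support_fun_le_iff using za p(2) by (force simp: inner_diff_left)
    with sub[of "- p"] a have "ereal (a + x \<bullet> (- p)) \<le> ereal (a - b)"
      by (metis order_trans plus_ereal.simps(1))
    then show False using p(1) by (simp add: inner_commute)
  qed
  moreover have "a \<le> x \<bullet> z"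
    using sub[of "- z"] a support_fun_zero[OF S(3)] by simp
  ultimately show ?thesis
    unfolding normal_cone_def using za by (force simp: inner_diff_right inner_commute)
qed

section \<open>Block minimization\<close>

text \<open>
  Along the segment from the minimizer \<open>y0\<close> to \<open>y\<close> the support functions are convex and the
  quadratic term is strongly convex with respect to the sum of the blocks. Comparing \<open>y0\<close>
  with the point at parameter \<open>t\<close>, dividing by \<open>t\<close> and letting \<open>t\<close> tend to zero yields the
  quadratic gain. The blocks themselves may fail to be unique, which is why only their sum
  appears.
\<close>

lemma block_minimizer_three_point:
  fixes K :: "'i \<Rightarrow> 'a::real_inner set" and b :: 'a and S :: "'i set"
  defines "\<Phi> \<equiv> \<lambda>y. ereal (1 / 2 * (norm (b - (\<Sum>\<alpha>\<in>S. y \<alpha>)))\<^sup>2)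
                        + (\<Sum>\<alpha>\<in>S. support_fun (K \<alpha>) (y \<alpha>))"
  assumes S: "finite S" and K: "\<And>\<alpha>. \<alpha> \<in> S \<Longrightarrow> 0 \<in> K \<alpha>"
    and min: "\<And>y. \<Phi> y0 \<le> \<Phi> y"
  shows "\<Phi> y0 + ereal (1 / 2 * (norm ((\<Sum>\<alpha>\<in>S. y \<alpha>) - (\<Sum>\<alpha>\<in>S. y0 \<alpha>)))\<^sup>2) \<le> \<Phi> y"
proof (cases "\<exists>\<alpha>\<in>S. support_fun (K \<alpha>) (y \<alpha>) = \<infinity>")
  case True
  then have "(\<Sum>\<alpha>\<in>S. support_fun (K \<alpha>) (y \<alpha>)) = \<infinity>" using S by (simp add: sum_Pinfty)
  then show ?thesis by (simp add: \<Phi>_def)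
next
  case False
  then have ny: "support_fun (K \<alpha>) (y \<alpha>) \<noteq> \<infinity>" if "\<alpha> \<in> S" for \<alpha>
    using that by blast
  define g where "g \<alpha> = real_of_ereal (support_fun (K \<alpha>) (y \<alpha>))" for \<alpha>
  have g: "support_fun (K \<alpha>) (y \<alpha>) = ereal (g \<alpha>)" if "\<alpha> \<in> S" for \<alpha>
    using support_fun_finite[OF K[OF that] ny[OF that]] unfolding g_def by force
  have \<Phi>y: "\<Phi> y = ereal (1 / 2 * (norm (b - (\<Sum>\<alpha>\<in>S. y \<alpha>)))\<^sup>2 + (\<Sum>\<alpha>\<in>S. g \<alpha>))"
    unfolding \<Phi>_def using g by simp
  have "\<Phi> y0 \<noteq> \<infinity>" using min[of y] \<Phi>y by auto
  then have n0: "support_fun (K \<alpha>) (y0 \<alpha>) \<noteq> \<infinity>" if "\<alpha> \<in> S" for \<alpha>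
    using S that unfolding \<Phi>_def by (auto simp: sum_Pinfty)
  define h where "h \<alpha> = real_of_ereal (support_fun (K \<alpha>) (y0 \<alpha>))" for \<alpha>
  have h: "support_fun (K \<alpha>) (y0 \<alpha>) = ereal (h \<alpha>)" if "\<alpha> \<in> S" for \<alpha>
    using support_fun_finite[OF K[OF that] n0[OF that]] unfolding h_def by force
  define A where "A = b - (\<Sum>\<alpha>\<in>S. y0 \<alpha>)"
  define B where "B = b - (\<Sum>\<alpha>\<in>S. y \<alpha>)"
  define G where "G = (\<Sum>\<alpha>\<in>S. g \<alpha>)"
  define H where "H = (\<Sum>\<alpha>\<in>S. h \<alpha>)"
  have \<Phi>y0: "\<Phi> y0 = ereal (1 / 2 * (norm A)\<^sup>2 + H)"
    unfolding \<Phi>_def A_def H_def using h by simp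
  have key: "(1 - t) * (1 / 2 * (norm (A - B))\<^sup>2) \<le> (1 / 2 * (norm B)\<^sup>2 + G) - (1 / 2 * (norm A)\<^sup>2 + H)"
    if t: "0 < t" "t < 1" for t
  proof -
    define v where "v = (\<lambda>\<alpha>. (1 - t) *\<^sub>R y0 \<alpha> + t *\<^sub>R y \<alpha>)"
    have "(\<Sum>\<alpha>\<in>S. support_fun (K \<alpha>) (v \<alpha>)) \<le> (\<Sum>\<alpha>\<in>S. ereal ((1 - t) * h \<alpha> + t * g \<alpha>))"
      unfolding v_def using t by (intro sum_mono support_fun_convex h g) auto
    also have "\<dots> = ereal ((1 - t) * H + t * G)"
      by (simp add: H_def G_def sum.distrib sum_distrib_left)
    finally have 1: "(\<Sum>\<alpha>\<in>S. support_fun (K \<alpha>) (v \<alpha>)) \<le> ereal ((1 - t) * H + t * G)" .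
    have 2: "b - (\<Sum>\<alpha>\<in>S. v \<alpha>) = (1 - t) *\<^sub>R A + t *\<^sub>R B"
    proof -
      have "(\<Sum>\<alpha>\<in>S. v \<alpha>) = (1 - t) *\<^sub>R (\<Sum>\<alpha>\<in>S. y0 \<alpha>) + t *\<^sub>R (\<Sum>\<alpha>\<in>S. y \<alpha>)"
        unfolding v_def by (simp only: sum.distrib scaleR_sum_right)
      then show ?thesis by (simp add: A_def B_def algebra_simps)
    qed
    have "\<Phi> v \<le> ereal (1 / 2 * (norm ((1 - t) *\<^sub>R A + t *\<^sub>R B))\<^sup>2) + ereal ((1 - t) * H + t * G)"
      unfolding \<Phi>_def 2 by (intro add_left_mono 1)
    from order_trans[OF min[of v] this]
    have "1 / 2 * (norm A)\<^sup>2 + H \<le> 1 / 2 * (norm ((1 - t) *\<^sub>R A + t *\<^sub>R B))\<^sup>2 + ((1 - t) * H + t * G)"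
      unfolding \<Phi>y0 by simp
    moreover have "(norm ((1 - t) *\<^sub>R A + t *\<^sub>R B))\<^sup>2
        = (1 - t) * (norm A)\<^sup>2 + t * (norm B)\<^sup>2 - t * (1 - t) * (norm (A - B))\<^sup>2"
      unfolding power2_norm_eq_inner
      by (simp add: inner_add_left inner_add_right inner_diff_left inner_diff_right
          inner_commute algebra_simps)
    ultimately have "1 / 2 * (norm A)\<^sup>2 + H
        \<le> 1 / 2 * ((1 - t) * (norm A)\<^sup>2 + t * (norm B)\<^sup>2 - t * (1 - t) * (norm (A - B))\<^sup>2)
          + ((1 - t) * H + t * G)"
      by (simp only:)
    then have "t * ((1 - t) * (1 / 2 * (norm (A - B))\<^sup>2))
        \<le> t * ((1 / 2 * (norm B)\<^sup>2 + G) - (1 / 2 * (norm A)\<^sup>2 + H))"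
      by (simp add: field_simps)
    then show ?thesis using t by simp
  qed
  have "1 / 2 * (norm (A - B))\<^sup>2 \<le> (1 / 2 * (norm B)\<^sup>2 + G) - (1 / 2 * (norm A)\<^sup>2 + H)"
  proof (rule field_le_mult_one_interval)
    fix s :: real assume "0 < s" "s < 1"
    then show "s * (1 / 2 * (norm (A - B))\<^sup>2) \<le> (1 / 2 * (norm B)\<^sup>2 + G) - (1 / 2 * (norm A)\<^sup>2 + H)"
      using key[of "1 - s"] by simp
  qed
  moreover have "A - B = (\<Sum>\<alpha>\<in>S. y \<alpha>) - (\<Sum>\<alpha>\<in>S. y0 \<alpha>)" by (simp add: A_def B_def)
  ultimately show ?thesis
    unfolding \<Phi>y0 \<Phi>y B_def[symmetric] G_def[symmetric] by (simp only: plus_ereal.simps ereal_less_eq)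
qed

text \<open>
  Changing a single block \<open>\<beta>\<close> by \<open>u\<close> in the three-point inequality, the terms \<open>\<parallel>u\<parallel>\<^sup>2 / 2\<close> on
  both sides cancel exactly, and what remains says that the primal point is a subgradient
  of the support function of block \<open>\<beta>\<close>.
\<close>

lemma block_minimizer_subgradient:
  fixes K :: "'i \<Rightarrow> 'a::real_inner set" and b :: 'a and S :: "'i set"
  defines "\<Phi> \<equiv> \<lambda>y. ereal (1 / 2 * (norm (b - (\<Sum>\<alpha>\<in>S. y \<alpha>)))\<^sup>2)
                        + (\<Sum>\<alpha>\<in>S. support_fun (K \<alpha>) (y \<alpha>))"
  assumes S: "finite S" and K: "\<And>\<alpha>. \<alpha> \<in> S \<Longrightarrow> 0 \<in> K \<alpha>"
    and min: "\<And>y. \<Phi> y0 \<le> \<Phi> y" and \<beta>: "\<beta> \<in> S"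
  shows "support_fun (K \<beta>) (y0 \<beta>) \<noteq> \<infinity>"
    and "support_fun (K \<beta>) (y0 \<beta>) + ereal ((b - (\<Sum>\<alpha>\<in>S. y0 \<alpha>)) \<bullet> u)
         \<le> support_fun (K \<beta>) (y0 \<beta> + u)"
proof -
  have "\<Phi> (\<lambda>_. 0) = ereal (1 / 2 * (norm b)\<^sup>2)"
    unfolding \<Phi>_def using K by (simp add: support_fun_zero)
  then have "\<Phi> y0 \<noteq> \<infinity>" using min[of "\<lambda>_. 0"] by auto
  then have n0: "support_fun (K \<alpha>) (y0 \<alpha>) \<noteq> \<infinity>" if "\<alpha> \<in> S" for \<alpha>
    using S that unfolding \<Phi>_def by (auto simp: sum_Pinfty)
  then show "support_fun (K \<beta>) (y0 \<beta>) \<noteq> \<infinity>" using \<beta> .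
  define h where "h \<alpha> = real_of_ereal (support_fun (K \<alpha>) (y0 \<alpha>))" for \<alpha>
  have h: "support_fun (K \<alpha>) (y0 \<alpha>) = ereal (h \<alpha>)" if "\<alpha> \<in> S" for \<alpha>
    using support_fun_finite[OF K[OF that] n0[OF that]] unfolding h_def by force
  define y where "y = y0(\<beta> := y0 \<beta> + u)"
  define A where "A = b - (\<Sum>\<alpha>\<in>S. y0 \<alpha>)"
  have rest: "(\<Sum>\<alpha>\<in>S - {\<beta>}. support_fun (K \<alpha>) (y0 \<alpha>)) = ereal (\<Sum>\<alpha>\<in>S - {\<beta>}. h \<alpha>)"
    using h by simp
  have sumy: "(\<Sum>\<alpha>\<in>S. y \<alpha>) = (\<Sum>\<alpha>\<in>S. y0 \<alpha>) + u"
    using S \<beta> by (simp add: y_def sum.remove[of S \<beta>])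
  have y: "\<Phi> y = ereal (1 / 2 * (norm (A - u))\<^sup>2)
      + (support_fun (K \<beta>) (y0 \<beta> + u) + ereal (\<Sum>\<alpha>\<in>S - {\<beta>}. h \<alpha>))"
    unfolding \<Phi>_def sumy using S \<beta> rest by (simp add: y_def A_def sum.remove[of S \<beta>] algebra_simps)
  have y0: "\<Phi> y0 = ereal (1 / 2 * (norm A)\<^sup>2 + (h \<beta> + (\<Sum>\<alpha>\<in>S - {\<beta>}. h \<alpha>)))"
    unfolding \<Phi>_def using S \<beta> rest h[OF \<beta>] by (simp add: A_def sum.remove[of S \<beta>])
  have "\<Phi> y0 + ereal (1 / 2 * (norm u)\<^sup>2) \<le> \<Phi> y"
    using block_minimizer_three_point[OF S K, where b = b and ?y0.0 = y0 and y = y] min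
    unfolding \<Phi>_def sumy by simp
  then have "ereal (1 / 2 * (norm A)\<^sup>2 + (h \<beta> + (\<Sum>\<alpha>\<in>S - {\<beta>}. h \<alpha>)) + 1 / 2 * (norm u)\<^sup>2)
     \<le> ereal (1 / 2 * (norm (A - u))\<^sup>2)
      + (support_fun (K \<beta>) (y0 \<beta> + u) + ereal (\<Sum>\<alpha>\<in>S - {\<beta>}. h \<alpha>))"
    unfolding y y0 by simp
  moreover have "(norm (A - u))\<^sup>2 = (norm A)\<^sup>2 - 2 * (A \<bullet> u) + (norm u)\<^sup>2"
    unfolding power2_norm_eq_inner by (simp add: inner_diff_left inner_diff_right inner_commute)
  ultimately have "ereal (h \<beta>) + ereal (A \<bullet> u) \<le> support_fun (K \<beta>) (y0 \<beta> + u)"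
    by (cases "support_fun (K \<beta>) (y0 \<beta> + u)") (auto simp: algebra_simps)
  then show "support_fun (K \<beta>) (y0 \<beta>) + ereal ((b - (\<Sum>\<alpha>\<in>S. y0 \<alpha>)) \<bullet> u)
         \<le> support_fun (K \<beta>) (y0 \<beta> + u)"
    using h[OF \<beta>] by (simp add: A_def)
qed

section \<open>Primal points after a block minimization\<close>

text \<open>
  With these sets the vertex and the edge blocks are instances of one construction, the
  support function of a set in the product space.
\<close>

fun block_set :: "('v::finite \<Rightarrow> (real ^ 'm) set) \<Rightarrow> 'v + 'v set \<Rightarrow> (real ^ 'm ^ 'v) set" where
  "block_set C (Inl i) = {x. x $ i \<in> C i}"
| "block_set C (Inr e) = edge_space e"

lemma component_fun_eq: "component_fun C \<alpha> = convex_indicator (block_set C \<alpha>)"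
  by (cases \<alpha>) (auto simp: convex_indicator_def fun_eq_iff)

lemma edge_space_eqD: "x \<in> edge_space e \<Longrightarrow> i \<in> e \<Longrightarrow> j \<in> e \<Longrightarrow> x $ i = x $ j"
  unfolding edge_space_def by blast

lemma edge_spaceI: "(\<And>i j. i \<in> e \<Longrightarrow> j \<in> e \<Longrightarrow> x $ i = x $ j) \<Longrightarrow> x \<in> edge_space e"
  unfolding edge_space_def by blast

lemma subspace_edge_space: "subspace (edge_space e :: (real ^ 'm ^ 'v::finite) set)"
proof (rule subspaceI)
  fix x y :: "real ^ 'm ^ 'v" and c :: real
  assume x: "x \<in> edge_space e"
  show "c *\<^sub>R x \<in> edge_space e"
  proof (rule edge_spaceI)
    fix i j assume "i \<in> e" "j \<in> e"
    from edge_space_eqD[OF x this] show "(c *\<^sub>R x) $ i = (c *\<^sub>R x) $ j"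
      by (simp only: vector_scaleR_component)
  qed
  assume y: "y \<in> edge_space e"
  show "x + y \<in> edge_space e"
  proof (rule edge_spaceI)
    fix i j assume ij: "i \<in> e" "j \<in> e"
    from edge_space_eqD[OF x ij] edge_space_eqD[OF y ij] show "(x + y) $ i = (x + y) $ j"
      by (simp only: vector_add_component)
  qed
qed (rule edge_spaceI, simp)

lemma zero_in_block_set: "(\<And>i. 0 \<in> C i) \<Longrightarrow> 0 \<in> block_set C \<alpha>"
  by (cases \<alpha>) (auto simp: subspace_0 subspace_edge_space)

lemma support_fun_eqI:
  assumes "\<And>c. (\<forall>x\<in>A. z \<bullet> x \<le> c) \<longleftrightarrow> (\<forall>x\<in>B. w \<bullet> x \<le> c)"
  shows "support_fun A z = support_fun B w"
proof (rule antisym)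
  show "support_fun A z \<le> support_fun B w"
    by (rule ereal_le_real) (use assms in \<open>simp only: support_fun_le_iff\<close>)
  show "support_fun B w \<le> support_fun A z"
    by (rule ereal_le_real) (use assms in \<open>simp only: support_fun_le_iff\<close>)
qed

lemma inner_blocks: "(u :: real ^ 'm ^ 'v::finite) \<bullet> w = (\<Sum>i\<in>UNIV. u $ i \<bullet> w $ i)"
  by (rule inner_vec_def)

lemma inner_supported_at:
  fixes z x :: "real ^ 'm ^ 'v::finite"
  assumes "\<And>j. j \<noteq> i \<Longrightarrow> z $ j = 0"
  shows "z \<bullet> x = z $ i \<bullet> x $ i"
proof -
  have "z \<bullet> x = (\<Sum>j\<in>UNIV. if j = i then z $ i \<bullet> x $ i else 0)"
    unfolding inner_blocks using assms by (intro sum.cong) auto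
  then show ?thesis by simp
qed

text \<open>
  A vector supported at \<open>i\<close> sees only the \<open>i\<close>-th component of the points of the cylinder
  over \<open>C i\<close>.
\<close>

lemma support_fun_vertex_block:
  fixes z :: "real ^ 'm ^ 'v::finite"
  assumes "\<And>j. j \<noteq> i \<Longrightarrow> z $ j = 0"
  shows "support_fun (block_set C (Inl i)) z = support_fun (C i) (z $ i)"
proof (rule support_fun_eqI)
  fix c
  have inner: "z \<bullet> x = z $ i \<bullet> x $ i" for x
    using inner_supported_at[OF assms] .
  show "(\<forall>x\<in>block_set C (Inl i). z \<bullet> x \<le> c) = (\<forall>x\<in>C i. z $ i \<bullet> x \<le> c)"
  proof (intro iffI ballI)
    fix y assume l: "\<forall>x\<in>block_set C (Inl i). z \<bullet> x \<le> c" and y: "y \<in> C i"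
    have "axis i y \<in> block_set C (Inl i)" using y by simp
    with l have "z \<bullet> axis i y \<le> c" by blast
    then show "z $ i \<bullet> y \<le> c" by (simp add: inner)
  next
    fix x assume "\<forall>y\<in>C i. z $ i \<bullet> y \<le> c" "x \<in> block_set C (Inl i)"
    then show "z \<bullet> x \<le> c" by (simp add: inner)
  qed
qed

text \<open>
  The cylinder over \<open>C i\<close> is unbounded in every component other than \<open>i\<close>, so a finite value
  of its support function forces those components of \<open>z\<close> to vanish.
\<close>

lemma vertex_block_support:
  fixes z :: "real ^ 'm ^ 'v::finite"
  assumes "0 \<in> C i" "support_fun (block_set C (Inl i)) z \<noteq> \<infinity>" "j \<noteq> i"
  shows "z $ j = 0"
proof (rule ccontr)
  assume nz: "z $ j \<noteq> 0"
  obtain a where a: "support_fun (block_set C (Inl i)) z = ereal a"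
    using support_fun_finite[of "block_set C (Inl i)" z] assms by auto
  define x where "x = axis j (((a + 1) / (z $ j \<bullet> z $ j)) *\<^sub>R z $ j)"
  have "x \<in> block_set C (Inl i)" using assms by (simp add: x_def axis_def)
  then have "z \<bullet> x \<le> a" using inner_le_support_fun a by (metis ereal_less_eq(3))
  moreover have "z \<bullet> x = z $ j \<bullet> (((a + 1) / (z $ j \<bullet> z $ j)) *\<^sub>R z $ j)"
    unfolding x_def by (simp add: inner_axis)
  ultimately show False using nz by simp
qed

text \<open>
  The form of the dual function in which a block subproblem is its restriction to some of
  the blocks. For nonempty sets it differs from \<open>dual_fun\<close> in being infinite when the dual of a vertex \<open>i\<close> is
  not supported at \<open>i\<close>.
\<close>

definition block_dual_fun ::
  "'v set set \<Rightarrow> ('v::finite \<Rightarrow> (real ^ 'm) set) \<Rightarrow> real ^ 'm \<Rightarrow>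
     ('v + 'v set \<Rightarrow> real ^ 'm ^ 'v) \<Rightarrow> ereal" where
  "block_dual_fun E C xbar z =
     ereal (1 / 2 * (norm (primal_point E xbar z))\<^sup>2)
     + (\<Sum>\<alpha>\<in>dual_index E. support_fun (block_set C \<alpha>) (z \<alpha>))"

lemma finite_dual_index: "finite (dual_index (E :: 'v::finite set set))"
  unfolding dual_index_def by simp

lemma dual_fun_eq_block_dual_fun:
  assumes "\<And>i j. j \<noteq> i \<Longrightarrow> z (Inl i) $ j = 0"
  shows "dual_fun E C xbar z = block_dual_fun E C xbar z"
proof -
  have "(\<Sum>\<alpha>\<in>dual_index E. support_fun (block_set C \<alpha>) (z \<alpha>))
      = (\<Sum>i\<in>UNIV. support_fun (C i) (z (Inl i) $ i)) + (\<Sum>e\<in>E. support_fun (edge_space e) (z (Inr e)))"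
    unfolding dual_index_def using support_fun_vertex_block[OF assms] by (simp add: sum.Plus)
  then show ?thesis
    unfolding dual_fun_def block_dual_fun_def by (simp add: add_ac)
qed

text \<open>
  The optimality conditions of a block subproblem together with the decrease it achieves.
  For an edge \<open>e\<close> the subgradient condition says that the primal point is orthogonal to the
  orthogonal complement of the edge space; the test vector that puts \<open>c\<close> at \<open>i\<close> and \<open>- c\<close> at
  \<open>j\<close>, where \<open>c\<close> is the difference of the two components, gives \<open>c \<bullet> c \<le> 0\<close>.
\<close>

lemma dykstra_step:
  fixes C :: "'v::finite \<Rightarrow> (real ^ 'm) set"
  assumes C: "\<And>i. closed (C i)" "\<And>i. convex (C i)" "\<And>i. 0 \<in> C i"
    and S: "S \<subseteq> dual_index E"
    and min: "is_arg_min (block_objective E C xbar S zold) (\<lambda>_. True) znew"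
    and unchanged: "\<And>\<alpha>. \<alpha> \<in> dual_index E - S \<Longrightarrow> znew \<alpha> = zold \<alpha>"
  shows dykstra_step_descent:
      "block_dual_fun E C xbar znew
         + ereal (1 / 2 * (norm (primal_point E xbar znew - primal_point E xbar zold))\<^sup>2)
       \<le> block_dual_fun E C xbar zold"
    and dykstra_step_finite:
      "\<alpha> \<in> S \<Longrightarrow> support_fun (block_set C \<alpha>) (znew \<alpha>) \<noteq> \<infinity>"
    and dykstra_step_vertex:
      "Inl i \<in> S \<Longrightarrow> znew (Inl i) $ i \<in> normal_cone (C i) (primal_point E xbar znew $ i)"
    and dykstra_step_edge:
      "Inr e \<in> S \<Longrightarrow> primal_point E xbar znew \<in> edge_space e"
proof -
  define b where "b = (\<chi> i. xbar) - (\<Sum>\<alpha>\<in>dual_index E - S. zold \<alpha>)"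
  define \<Phi> where "\<Phi> = (\<lambda>y. ereal (1 / 2 * (norm (b - (\<Sum>\<alpha>\<in>S. y \<alpha>)))\<^sup>2)
                        + (\<Sum>\<alpha>\<in>S. support_fun (block_set C \<alpha>) (y \<alpha>)))"
  define R where "R = (\<Sum>\<alpha>\<in>dual_index E - S. support_fun (block_set C \<alpha>) (zold \<alpha>))"
  have fin: "finite S" using S finite_dual_index finite_subset by blast
  have K: "0 \<in> block_set C \<alpha>" for \<alpha> using C(3) by (rule zero_in_block_set)
  have "\<Phi> = block_objective E C xbar S zold"
    by (simp add: \<Phi>_def b_def block_objective_def component_fun_eq fun_eq_iff)
  with min have min\<Phi>: "\<Phi> znew \<le> \<Phi> y" for y
    by (simp add: is_arg_min_def not_less)
  have pp: "primal_point E xbar y = b - (\<Sum>\<alpha>\<in>S. y \<alpha>)"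
    and bd: "block_dual_fun E C xbar y = \<Phi> y + R"
    if "\<And>\<alpha>. \<alpha> \<in> dual_index E - S \<Longrightarrow> y \<alpha> = zold \<alpha>" for y
  proof -
    show p: "primal_point E xbar y = b - (\<Sum>\<alpha>\<in>S. y \<alpha>)"
      unfolding primal_point_def b_def
      using sum.subset_diff[OF S finite_dual_index, of y] that by (simp add: diff_diff_eq)
    have "(\<Sum>\<alpha>\<in>dual_index E. support_fun (block_set C \<alpha>) (y \<alpha>))
        = R + (\<Sum>\<alpha>\<in>S. support_fun (block_set C \<alpha>) (y \<alpha>))"
      unfolding R_def
      using sum.subset_diff[OF S finite_dual_index, of "\<lambda>\<alpha>. support_fun (block_set C \<alpha>) (y \<alpha>)"] that
      by simp
    then show "block_dual_fun E C xbar y = \<Phi> y + R"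
      unfolding block_dual_fun_def p \<Phi>_def by (simp add: add_ac)
  qed
  have pn: "primal_point E xbar znew = b - (\<Sum>\<alpha>\<in>S. znew \<alpha>)"
    and bn: "block_dual_fun E C xbar znew = \<Phi> znew + R"
    using unchanged by (blast intro: pp bd)+
  note po = pp[of zold, OF refl] and bo = bd[of zold, OF refl]
  have "\<Phi> znew + ereal (1 / 2 * (norm ((\<Sum>\<alpha>\<in>S. zold \<alpha>) - (\<Sum>\<alpha>\<in>S. znew \<alpha>)))\<^sup>2) \<le> \<Phi> zold"
    unfolding \<Phi>_def
    by (rule block_minimizer_three_point[OF fin K]) (use min\<Phi> in \<open>simp add: \<Phi>_def\<close>)
  then have "\<Phi> znew + ereal (1 / 2 * (norm (primal_point E xbar znew - primal_point E xbar zold))\<^sup>2) \<le> \<Phi> zold"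
    unfolding pn po by (simp add: norm_minus_commute)
  from add_right_mono[OF this, of R] show "block_dual_fun E C xbar znew
         + ereal (1 / 2 * (norm (primal_point E xbar znew - primal_point E xbar zold))\<^sup>2)
       \<le> block_dual_fun E C xbar zold"
    unfolding bn bo
    by (simp only: add_ac)
  have sub: "support_fun (block_set C \<alpha>) (znew \<alpha>) + ereal (primal_point E xbar znew \<bullet> u)
         \<le> support_fun (block_set C \<alpha>) (znew \<alpha> + u)"
    if "\<alpha> \<in> S" for \<alpha> u
    unfolding pn
    by (rule block_minimizer_subgradient(2)[OF fin K _ that]) (use min\<Phi> in \<open>simp add: \<Phi>_def\<close>)
  show fin': "support_fun (block_set C \<alpha>) (znew \<alpha>) \<noteq> \<infinity>" if "\<alpha> \<in> S" for \<alpha>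
    by (rule block_minimizer_subgradient(1)[OF fin K _ that, of b])
      (use min\<Phi> in \<open>simp add: \<Phi>_def\<close>)
  show "znew (Inl i) $ i \<in> normal_cone (C i) (primal_point E xbar znew $ i)" if i: "Inl i \<in> S" for i
  proof (rule normal_cone_if_subgradient_of_support_fun)
    have off: "znew (Inl i) $ j = 0" if "j \<noteq> i" for j
      using vertex_block_support[OF C(3) fin'[OF i] that] .
    note eq = support_fun_vertex_block[OF off, where C = C]
    show "support_fun (C i) (znew (Inl i) $ i) \<noteq> \<infinity>" using fin'[OF i] eq by simp
    fix u
    have "support_fun (block_set C (Inl i)) (znew (Inl i) + axis i u)
        = support_fun (C i) ((znew (Inl i) + axis i u) $ i)"
      by (rule support_fun_vertex_block) (use off in \<open>simp add: axis_def\<close>)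
    then show "support_fun (C i) (znew (Inl i) $ i) + ereal (primal_point E xbar znew $ i \<bullet> u)
        \<le> support_fun (C i) (znew (Inl i) $ i + u)"
      using sub[OF i, of "axis i u"] eq by (simp add: inner_axis)
  qed (use C in auto)
  show "primal_point E xbar znew \<in> edge_space e" if e: "Inr e \<in> S" for e
  proof (rule edge_spaceI)
    fix i j assume ij: "i \<in> e" "j \<in> e"
    define x where "x = primal_point E xbar znew"
    define c where "c = x $ i - x $ j"
    define u where "u = (axis i c - axis j c :: real ^ 'm ^ 'v)"
    have orth: "u \<bullet> y = 0" if "y \<in> edge_space e" for y
    proof -
      have "y $ i = y $ j" using edge_space_eqD[OF that ij] .
      then show ?thesis by (simp add: u_def inner_diff_left inner_axis')
    qed
    have zorth: "znew (Inr e) \<bullet> y = 0" if "y \<in> edge_space e" for y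
      using support_fun_subspace_orthogonal[OF subspace_edge_space] fin'[OF e] that by simp
    have "support_fun (edge_space e) (znew (Inr e)) = 0"
      "support_fun (edge_space e) (znew (Inr e) + u) = 0"
      by (intro support_fun_orthogonal; simp add: subspace_0 subspace_edge_space orth zorth inner_add_left)+
    then have "x \<bullet> u \<le> 0" using sub[OF e, of u] by (simp add: x_def)
    moreover have "x \<bullet> u = c \<bullet> c"
      by (simp add: u_def c_def inner_diff_right inner_diff_left inner_axis)
    ultimately have "c \<bullet> c = 0" using inner_ge_zero[of c] by linarith
    then have "c = 0" by simp
    then show "primal_point E xbar znew $ i = primal_point E xbar znew $ j"
      by (simp add: c_def x_def)
  qed
qed

section \<open>Geometry of the dual problem\<close>

lemma normal_cone_zeroI: "0 \<in> S \<Longrightarrow> (\<And>y. y \<in> S \<Longrightarrow> z \<bullet> y \<le> 0) \<Longrightarrow> z \<in> normal_cone S 0"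
  by (simp add: normal_cone_def)

lemma normal_cone_zeroD: "z \<in> normal_cone S 0 \<Longrightarrow> y \<in> S \<Longrightarrow> z \<bullet> y \<le> 0"
  by (simp add: normal_cone_def)

lemma normal_cone_scaleR:
  assumes "z \<in> normal_cone S x" "0 \<le> a"
  shows "a *\<^sub>R z \<in> normal_cone S x"
  using assms by (auto simp: normal_cone_def mult_nonneg_nonpos)

lemma normal_product_inner_nonpos:
  fixes w a :: "real ^ 'm ^ 'v::finite"
  assumes "w \<in> normal_product C 0" "\<And>i. a $ i \<in> C i"
  shows "w \<bullet> a \<le> 0"
  unfolding inner_blocks using assms
  by (intro sum_nonpos) (auto simp: normal_product_def intro: normal_cone_zeroD)

lemma closed_sum_constraint: "closed (sum_constraint xbar :: (real ^ 'm ^ 'v::finite) set)"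
  unfolding sum_constraint_def by (intro closed_Collect_eq continuous_intros)

lemma closed_normal_product:
  fixes C :: "'v::finite \<Rightarrow> (real ^ 'm) set"
  assumes "\<And>i. 0 \<in> C i"
  shows "closed (normal_product C 0)"
proof -
  have "normal_product C 0 = (\<Inter>i. \<Inter>y\<in>C i. {z. z $ i \<bullet> y \<le> 0})"
    using assms by (auto simp: normal_product_def normal_cone_def)
  also have "closed \<dots>"
    by (intro closed_INT ballI closed_Collect_le continuous_intros)
  finally show ?thesis .
qed

lemma sum_constraint_diff_orthogonal_const:
  fixes u v :: "real ^ 'm ^ 'v::finite"
  assumes "u \<in> sum_constraint xbar" "v \<in> sum_constraint xbar"
  shows "(u - v) \<bullet> (\<chi> i. c) = 0"
proof -
  have "(u - v) \<bullet> (\<chi> i. c) = (\<Sum>i\<in>UNIV. (u - v) $ i) \<bullet> c"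
    unfolding inner_blocks by (simp add: inner_sum_left)
  also have "(\<Sum>i\<in>UNIV. (u - v) $ i) = 0"
    using assms by (simp add: sum_constraint_def sum_subtractf)
  finally show ?thesis by simp
qed

text \<open>
  Both \<open>z + x\<close> and \<open>zs\<close> satisfy the sum constraint, so \<open>z - zs + x\<close> is orthogonal to vectors
  with equal components, and subtracting such a vector from \<open>x\<close> is free. The left-hand side
  dominates the dual value, so this turns near-consensus of the components of \<open>x\<close> into near
  optimality.
\<close>

lemma duality_gap_bound:
  fixes z zs x :: "real ^ 'm ^ 'v::finite"
  assumes "z + x \<in> sum_constraint xbar"
    and "zs \<in> normal_product C 0" "zs \<in> sum_constraint xbar"
    and "\<And>i. x $ i \<in> C i"
  shows "z \<bullet> x + (norm x)\<^sup>2 \<le> norm (z - zs + x) * norm (x - (\<chi> i. c))"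
proof -
  have "z \<bullet> x + (norm x)\<^sup>2 \<le> (z - zs + x) \<bullet> x"
    using normal_product_inner_nonpos[OF assms(2,4)]
    by (simp add: power2_norm_eq_inner inner_add_left inner_diff_left)
  also have "\<dots> = (z - zs + x) \<bullet> (x - (\<chi> i. c))"
    using sum_constraint_diff_orthogonal_const[OF assms(1,3), of c]
    by (simp add: inner_diff_right algebra_simps)
  also have "\<dots> \<le> norm (z - zs + x) * norm (x - (\<chi> i. c))"
    by (rule norm_cauchy_schwarz)
  finally show ?thesis .
qed

text \<open>
  A convex lower semicontinuous function with a nonempty bounded set of minimizers has
  bounded sublevel sets, here for the dual function, whose minimal value is \<open>0\<close>. The
  hypotheses on \<open>z\<close> and \<open>x\<close> hold when the dual value is bounded in terms of \<open>c\<close>. If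
  arbitrarily distant such points existed, they could be pulled back along the segments to
  a minimizer \<open>zs\<close> onto a sphere around \<open>zs\<close>; by convexity the values there tend to zero,
  so a limit point on the sphere would be a minimizer outside the known bound.
\<close>

lemma dual_level_set_bounded:
  fixes C :: "'v::finite \<Rightarrow> (real ^ 'm) set" and zs :: "real ^ 'm ^ 'v"
  assumes C: "\<And>i. 0 \<in> C i"
    and zs: "zs \<in> normal_product C 0 \<inter> sum_constraint xbar"
    and bdd: "bounded (normal_product C 0 \<inter> sum_constraint xbar :: (real ^ 'm ^ 'v) set)"
  obtains R where "0 < R"
    and "\<And>z x. z + x \<in> sum_constraint xbar \<Longrightarrow> norm x \<le> c \<Longrightarrow>
           (\<And>a. (\<And>i. a $ i \<in> C i) \<Longrightarrow> z \<bullet> a \<le> c) \<Longrightarrow> norm (z :: real ^ 'm ^ 'v) \<le> R"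
proof -
  define level where "level z \<longleftrightarrow> (\<exists>x. z + x \<in> sum_constraint xbar \<and> norm x \<le> c \<and>
      (\<forall>a. (\<forall>i. a $ i \<in> C i) \<longrightarrow> z \<bullet> a \<le> c))" for z :: "real ^ 'm ^ 'v"
  obtain B where B: "\<And>p. p \<in> normal_product C 0 \<inter> sum_constraint xbar \<Longrightarrow> norm (p :: real ^ 'm ^ 'v) \<le> B"
    using bdd unfolding bounded_iff by blast
  \<comment> \<open>two dual optima are at most \<open>2 * B\<close> apart, so none lies on the sphere of radius \<open>r\<close>
    around \<open>zs\<close>\<close>
  define r where "r = 2 * B + 1"
  have r: "0 < r" using B[OF zs] norm_ge_zero[of zs] unfolding r_def by linarith
  have "\<exists>R. \<forall>z. level z \<longrightarrow> norm z \<le> R"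
  proof (rule ccontr)
    assume "\<nexists>R. \<forall>z. level z \<longrightarrow> norm z \<le> R"
    then have "\<forall>k. \<exists>z. level z \<and> norm z > norm zs + r * real (Suc k)"
      by (meson not_less)
    then obtain z where z: "\<And>k. level (z k)" "\<And>k. norm (z k) > norm zs + r * real (Suc k)"
      by metis
    have "\<forall>k. \<exists>x. z k + x \<in> sum_constraint xbar \<and> norm x \<le> c \<and>
      (\<forall>a. (\<forall>i. a $ i \<in> C i) \<longrightarrow> z k \<bullet> a \<le> c)"
      using z(1) unfolding level_def by blast
    then obtain x where x: "\<And>k. z k + x k \<in> sum_constraint xbar" "\<And>k. norm (x k) \<le> c"
      "\<And>k a. (\<And>i. a $ i \<in> C i) \<Longrightarrow> z k \<bullet> a \<le> c"
      by metis
    define t where "t k = r / norm (z k - zs)" for k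
    define p where "p k = zs + t k *\<^sub>R (z k - zs)" for k
    have far: "r * real (Suc k) < norm (z k - zs)" for k
      using z(2)[of k] norm_triangle_ineq2[of "z k" zs] by linarith
    have npos: "0 < norm (z k - zs)" for k
      using far[of k] r by (smt (verit) of_nat_0_le_iff mult_nonneg_nonneg)
    have t0: "0 < t k" for k using r npos[of k] by (simp add: t_def)
    have t1: "t k \<le> 1 / real (Suc k)" for k
      using far[of k] npos[of k] by (simp add: t_def field_simps)
    have tlim: "t \<longlonglongrightarrow> 0"
      by (rule tendsto_sandwich[OF _ _ tendsto_const LIMSEQ_inverse_real_of_nat])
        (use t0 t1 in \<open>auto intro!: always_eventually simp: less_imp_le inverse_eq_divide\<close>)
    have le1: "t k \<le> 1" for k
      using t1[of k] by (rule order_trans) simp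
    have "p k \<in> sphere zs r" for k
      using npos[of k] r by (simp add: p_def t_def dist_norm)
    then obtain q s where q: "q \<in> sphere zs r" "strict_mono s" "(p \<circ> s) \<longlonglongrightarrow> q"
      using compact_sphere[of zs r] unfolding compact_def by metis
    have ts: "(\<lambda>k. t (s k)) \<longlonglongrightarrow> 0"
      using LIMSEQ_subseq_LIMSEQ[OF tlim q(2)] by (simp add: o_def)
    have "q \<in> normal_product C 0"
      unfolding normal_product_def
    proof (intro CollectI allI normal_cone_zeroI C)
      fix i y assume y: "y \<in> C i"
      define a where "a = (axis i y :: real ^ 'm ^ 'v)"
      have a: "a $ j \<in> C j" for j using y C by (simp add: a_def axis_def)
      have "p k \<bullet> a \<le> t k * c" for k
      proof -
        have "p k \<bullet> a = (1 - t k) * (zs \<bullet> a) + t k * (z k \<bullet> a)"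
          by (simp add: p_def inner_add_left inner_diff_left algebra_simps)
        also have "\<dots> \<le> (1 - t k) * 0 + t k * c"
          using normal_product_inner_nonpos[of zs C a] zs a x(3)[of a k] le1[of k] t0[of k]
          by (intro add_mono mult_left_mono) auto
        finally show ?thesis by simp
      qed
      then have "(p \<circ> s) k \<bullet> a \<le> t (s k) * c" for k by simp
      moreover have "(\<lambda>k. (p \<circ> s) k \<bullet> a) \<longlonglongrightarrow> q \<bullet> a"
        by (intro tendsto_intros q(3))
      moreover have "(\<lambda>k. t (s k) * c) \<longlonglongrightarrow> 0 * c"
        by (intro tendsto_intros ts)
      ultimately have "q \<bullet> a \<le> 0 * c"
        by (intro LIMSEQ_le) auto
      then show "q $ i \<bullet> y \<le> 0" by (simp add: a_def inner_axis)
    qed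
    moreover have "q \<in> sum_constraint xbar"
    proof (rule closed_sequentially[OF closed_sum_constraint])
      fix k
      have "(\<Sum>i\<in>UNIV. (p k + t k *\<^sub>R x k) $ i)
          = (1 - t k) *\<^sub>R (\<Sum>i\<in>UNIV. zs $ i) + t k *\<^sub>R (\<Sum>i\<in>UNIV. (z k + x k) $ i)" for k
        unfolding scaleR_sum_right sum.distrib[symmetric]
        by (intro sum.cong refl) (simp add: p_def algebra_simps)
      moreover have "(\<Sum>i\<in>UNIV. zs $ i) = real CARD('v) *\<^sub>R xbar"
        "(\<Sum>i\<in>UNIV. (z k + x k) $ i) = real CARD('v) *\<^sub>R xbar" for k
        using zs x(1)[of k] unfolding sum_constraint_def by blast+
      ultimately have "(\<Sum>i\<in>UNIV. (p k + t k *\<^sub>R x k) $ i)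
          = (1 - t k) *\<^sub>R (real CARD('v) *\<^sub>R xbar) + t k *\<^sub>R (real CARD('v) *\<^sub>R xbar)" for k
        by (simp only:)
      then have "p k + t k *\<^sub>R x k \<in> sum_constraint xbar" for k
        unfolding sum_constraint_def mem_Collect_eq
        by (simp only: scaleR_left_diff_distrib scaleR_one diff_add_cancel)
      then show "(p \<circ> s) k + t (s k) *\<^sub>R x (s k) \<in> sum_constraint xbar" by simp
    next
      have "(\<lambda>k. t (s k) *\<^sub>R x (s k)) \<longlonglongrightarrow> 0"
      proof (rule Lim_null_comparison[OF always_eventually])
        show "\<forall>k. norm (t (s k) *\<^sub>R x (s k)) \<le> t (s k) * c"
          using x(2) t0 by (auto simp: less_imp_le intro!: mult_left_mono)
        show "(\<lambda>k. t (s k) * c) \<longlonglongrightarrow> 0"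
          using tendsto_mult_right[OF ts, of c] by simp
      qed
      from tendsto_add[OF q(3) this]
      show "(\<lambda>k. (p \<circ> s) k + t (s k) *\<^sub>R x (s k)) \<longlonglongrightarrow> q" by simp
    qed
    ultimately have "norm q \<le> B" by (intro B) auto
    moreover have "norm (zs - q) = r" using q(1) by (simp add: dist_norm)
    ultimately show False
      using B[OF zs] norm_triangle_ineq4[of zs q] by (simp add: r_def)
  qed
  then obtain R where R: "\<And>z. level z \<Longrightarrow> norm z \<le> R" by blast
  show ?thesis
  proof (rule that[of "max R 1"])
    fix z x :: "real ^ 'm ^ 'v"
    assume "z + x \<in> sum_constraint xbar" "norm x \<le> c"
      "\<And>a. (\<And>i. a $ i \<in> C i) \<Longrightarrow> z \<bullet> a \<le> c"
    then have "level z" unfolding level_def by blast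
    from R[OF this] show "norm z \<le> max R 1" by simp
  qed simp
qed

text \<open>
  Along a path the differences across its edges add up. There are finitely many pairs of
  vertices, so one constant serves for all of them.
\<close>

lemma connected_graph_variation:
  fixes E :: "'v::finite set set"
  assumes "connected_graph E"
  obtains k where "0 < k"
    and "\<And>(x :: real ^ 'm ^ 'v) \<delta> i. 0 \<le> \<delta> \<Longrightarrow>
           (\<And>i j. {i, j} \<in> E \<Longrightarrow> norm (x $ i - x $ j) \<le> \<delta>) \<Longrightarrow>
           norm (x - (\<chi> j. x $ i)) \<le> k * \<delta>"
proof -
  \<comment> \<open>a path from \<open>u\<close> to \<open>v\<close> with \<open>k\<close> edges gives \<open>P u v k\<close>\<close>
  define P where "P u v k \<longleftrightarrow> (\<forall>(x :: real ^ 'm ^ 'v) \<delta>. 0 \<le> \<delta> \<longrightarrow>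
           (\<forall>i j. {i, j} \<in> E \<longrightarrow> norm (x $ i - x $ j) \<le> \<delta>) \<longrightarrow> norm (x $ v - x $ u) \<le> k * \<delta>)"
    for u v k
  have "\<exists>k\<ge>0. P u v k" if "(u, v) \<in> {(i, j). {i, j} \<in> E}\<^sup>*" for u v
    using that
  proof (induction rule: rtrancl_induct)
    case base
    then show ?case by (intro exI[of _ 0]) (simp add: P_def)
  next
    case (step v w)
    then obtain k where k: "0 \<le> k" "P u v k" by blast
    have "P u w (k + 1)"
      unfolding P_def
    proof (intro allI impI)
      fix x :: "real ^ 'm ^ 'v" and \<delta> :: real
      assume \<delta>: "0 \<le> \<delta>" "\<forall>i j. {i, j} \<in> E \<longrightarrow> norm (x $ i - x $ j) \<le> \<delta>"
      have "norm (x $ v - x $ u) \<le> k * \<delta>" using k(2) \<delta> unfolding P_def by blast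
      moreover have "norm (x $ v - x $ w) \<le> \<delta>" using \<delta>(2) step(2) by blast
      ultimately show "norm (x $ w - x $ u) \<le> (k + 1) * \<delta>"
        using norm_triangle_ineq[of "x $ w - x $ v" "x $ v - x $ u"]
        by (simp add: algebra_simps norm_minus_commute)
    qed
    then show ?case using k(1) by (intro exI[of _ "k + 1"]) simp
  qed
  then have "\<forall>u v. \<exists>k\<ge>0. P u v k" using assms unfolding connected_graph_def by blast
  then obtain f where f: "\<And>u v. 0 \<le> f u v" "\<And>u v. P u v (f u v)" by metis
  define k where "k = 1 + (\<Sum>u\<in>UNIV. \<Sum>v\<in>UNIV. f u v)"
  show ?thesis
  proof (rule that[of k])
    show "0 < k" unfolding k_def using f(1) by (simp add: add_pos_nonneg sum_nonneg)
    fix x :: "real ^ 'm ^ 'v" and \<delta> :: real and i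
    assume \<delta>: "0 \<le> \<delta>" "\<And>i j. {i, j} \<in> E \<Longrightarrow> norm (x $ i - x $ j) \<le> \<delta>"
    have "norm (x - (\<chi> j. x $ i)) \<le> (\<Sum>v\<in>UNIV. norm (x $ v - x $ i))"
      unfolding norm_vec_def by (rule order_trans[OF L2_set_le_sum]) auto
    also have "\<dots> \<le> (\<Sum>v\<in>UNIV. f i v * \<delta>)"
      using f(2) \<delta> unfolding P_def by (intro sum_mono) blast
    also have "\<dots> = (\<Sum>v\<in>UNIV. f i v) * \<delta>" by (simp add: sum_distrib_right)
    also have "\<dots> \<le> k * \<delta>"
    proof (rule mult_right_mono[OF _ \<delta>(1)])
      have "(\<Sum>v\<in>UNIV. f i v) \<le> (\<Sum>u\<in>UNIV. \<Sum>v\<in>UNIV. f u v)"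
        by (rule member_le_sum) (auto simp: f(1) sum_nonneg)
      then show "(\<Sum>v\<in>UNIV. f i v) \<le> k" by (simp add: k_def)
    qed
    finally show "norm (x - (\<chi> j. x $ i)) \<le> k * \<delta>" .
  qed
qed

definition edge_sums :: "'v set set \<Rightarrow> (real ^ 'm ^ 'v::finite) set" where
  "edge_sums E = {\<Sum>e\<in>E. f e |f. \<forall>e\<in>E. f e \<in> orthogonal_comp (edge_space e)}"

lemma edge_sums_add:
  assumes "u \<in> edge_sums E" "v \<in> edge_sums E"
  shows "u + v \<in> edge_sums E"
proof -
  obtain f g where "u = (\<Sum>e\<in>E. f e)" "v = (\<Sum>e\<in>E. g e)"
    and "\<forall>e\<in>E. f e \<in> orthogonal_comp (edge_space e)" "\<forall>e\<in>E. g e \<in> orthogonal_comp (edge_space e)"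
    using assms unfolding edge_sums_def by blast
  then show ?thesis unfolding edge_sums_def
    by (intro CollectI exI[of _ "\<lambda>e. f e + g e"])
      (simp add: sum.distrib subspace_add subspace_orthogonal_comp)
qed

lemma edge_sums_zero: "0 \<in> edge_sums E"
  unfolding edge_sums_def
  by (intro CollectI exI[of _ "\<lambda>e. 0"]) (simp add: subspace_0 subspace_orthogonal_comp)

lemma edge_sums_edge:
  fixes E :: "'v::finite set set"
  assumes "{i, j} \<in> E"
  shows "axis i c - axis j c \<in> (edge_sums E :: (real ^ 'm ^ 'v) set)"
proof -
  define u where "u = (axis i c - axis j c :: real ^ 'm ^ 'v)"
  have "u \<in> orthogonal_comp (edge_space {i, j})"
    unfolding orthogonal_comp_def orthogonal_def
  proof (intro CollectI ballI)
    fix y :: "real ^ 'm ^ 'v" assume "y \<in> edge_space {i, j}"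
    then have "y $ i = y $ j" by (rule edge_space_eqD) auto
    then show "y \<bullet> u = 0" by (simp add: u_def inner_diff_right inner_axis)
  qed
  moreover have "(\<Sum>e\<in>E. if e = {i, j} then u else 0) = u" using assms by simp
  ultimately show ?thesis unfolding edge_sums_def u_def[symmetric]
    by (intro CollectI exI[of _ "\<lambda>e. if e = {i, j} then u else 0"])
      (auto simp: subspace_0 subspace_orthogonal_comp)
qed

text \<open>
  For a connected graph the orthogonal complements of the edge spaces together span all
  vectors whose components add up to zero: moving a vector \<open>c\<close> from one vertex to another is
  a telescoping sum over a path, and a vector with zero sum is assembled by moving each
  of its components from one common vertex.
\<close>

lemma zero_sum_in_edge_sums:
  fixes y :: "real ^ 'm ^ 'v::finite"
  assumes "connected_graph E" "(\<Sum>i\<in>UNIV. y $ i) = 0"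
  shows "y \<in> edge_sums E"
proof -
  have path: "axis u c - axis v c \<in> edge_sums E" for u v and c :: "real ^ 'm"
  proof -
    have "(u, v) \<in> {(i, j). {i, j} \<in> E}\<^sup>*" using assms unfolding connected_graph_def by blast
    then show ?thesis
    proof (induction rule: rtrancl_induct)
      case base
      then show ?case by (simp add: edge_sums_zero)
    next
      case (step v w)
      then show ?case using edge_sums_add[OF step.IH edge_sums_edge, of v w c] by simp
    qed
  qed
  \<comment> \<open>an arbitrary vertex from which all components are moved\<close>
  fix v0 :: 'v
  have sums: "(\<Sum>i\<in>I. axis i (y $ i) - axis v0 (y $ i)) \<in> edge_sums E" if "finite I" for I
    using that by induction (auto simp: edge_sums_zero edge_sums_add path)
  have "(\<Sum>i\<in>UNIV. axis i (y $ i) - axis v0 (y $ i)) = y"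
  proof (rule vec_eq_iff[THEN iffD2], rule allI)
    fix j
    have "(\<Sum>i\<in>UNIV. axis i (y $ i) - axis v0 (y $ i)) $ j
       = (\<Sum>i\<in>UNIV. if j = i then y $ i else 0) - (\<Sum>i\<in>UNIV. if j = v0 then y $ i else 0)"
      by (simp add: sum_subtractf axis_def eq_commute)
    then show "(\<Sum>i\<in>UNIV. axis i (y $ i) - axis v0 (y $ i)) $ j = y $ j"
      using assms(2) by (cases "j = v0") auto
  qed
  with sums[of UNIV] show ?thesis by simp
qed

text \<open>
  The regularity assumption bounds the normals \<open>\<zeta> i\<close> as soon as edge duals exist that bring
  the primal point close to \<open>0\<close>. For normals at \<open>0\<close> that satisfy the sum constraint,
  \<open>zero_sum_in_edge_sums\<close> supplies edge duals that make the primal point equal to \<open>0\<close>.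
\<close>

lemma dual_optimal_set_bounded:
  fixes C :: "'v::finite \<Rightarrow> (real ^ 'm) set"
  assumes "sets_regular E C xbar 0" "connected_graph E"
  shows "bounded (normal_product C 0 \<inter> sum_constraint xbar :: (real ^ 'm ^ 'v) set)"
proof -
  obtain U Mmax Mmin \<kappa> where U: "0 \<in> U" and
    r: "\<forall>x \<zeta> z.
        (\<forall>i. x i \<in> U \<and> \<zeta> i \<in> normal_cone (C i) (x i)) \<and>
        (\<forall>i. z (Inl i) = axis i (\<zeta> i)) \<and>
        (\<forall>e\<in>E. z (Inr e) \<in> orthogonal_comp (edge_space e)) \<and>
        (\<forall>j. primal_point E xbar z $ j \<in> U) \<longrightarrow>
        (\<forall>i. Mmin \<le> norm (\<zeta> i) \<and> norm (\<zeta> i) \<le> Mmax) \<and>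
        (\<Inter>i. normal_hyperplane (\<zeta> i) (x i)) \<noteq> {} \<and>
        (\<forall>y. infdist y (\<Inter>i. normal_hyperplane (\<zeta> i) (x i))
               \<le> \<kappa> * (MAX i. infdist y (normal_hyperplane (\<zeta> i) (x i))))"
    using assms(1) unfolding sets_regular_def by (elim exE conjE) (rule that)
  have reg: "norm (\<zeta> i) \<le> Mmax"
    if "\<And>i. \<zeta> i \<in> normal_cone (C i) 0" "\<And>i. z (Inl i) = axis i (\<zeta> i)"
      "\<And>e. e \<in> E \<Longrightarrow> z (Inr e) \<in> orthogonal_comp (edge_space e)"
      "\<And>j. primal_point E xbar z $ j \<in> U" for \<zeta> z i
    using that r[THEN spec, of "\<lambda>_. 0", THEN spec, of \<zeta>, THEN spec, of z, THEN mp] U by simp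
  have "norm p \<le> (\<Sum>i\<in>(UNIV::'v set). Mmax)"
    if p: "p \<in> normal_product C 0" "p \<in> sum_constraint xbar" for p :: "real ^ 'm ^ 'v"
  proof -
    have "(\<chi> i. xbar) - p \<in> edge_sums E"
      using p(2) by (intro zero_sum_in_edge_sums assms(2)) (simp add: sum_subtractf sum_constraint_def sum_constant_scaleR del: sum_constant)
    then obtain f where f: "(\<chi> i. xbar) - p = (\<Sum>e\<in>E. f e)"
      "\<forall>e\<in>E. f e \<in> orthogonal_comp (edge_space e)"
      unfolding edge_sums_def by blast
    define z where "z = case_sum (\<lambda>i. axis i (p $ i)) f"
    have "(\<Sum>i\<in>UNIV. axis i (p $ i)) = p"
      by (simp add: vec_eq_iff axis_def)
    then have "primal_point E xbar z = 0"
      unfolding primal_point_def dual_index_def z_def using f(1)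
      by (simp add: sum.Plus algebra_simps)
    then have "norm (p $ i) \<le> Mmax" for i
      using p(1) f(2) U by (intro reg[of "\<lambda>i. p $ i" z i]) (auto simp: normal_product_def z_def)
    then have "(\<Sum>i\<in>UNIV. norm (p $ i)) \<le> (\<Sum>i\<in>(UNIV::'v set). Mmax)"
      by (intro sum_mono)
    then show ?thesis
      unfolding norm_vec_def by (intro order_trans[OF L2_set_le_sum]) auto
  qed
  then show ?thesis unfolding bounded_iff by blast
qed

text \<open>
  Each normal at \<open>x $ i\<close> is within \<open>\<kappa>3 * R * norm x\<close> of a normal at \<open>0\<close> obtained by giving
  the nearby direction the same length. The resulting vector nearly satisfies the sum
  constraint, because \<open>z + x\<close> satisfies it exactly, and linear regularity of the normal
  cones then yields a dual optimum at a distance of the same order.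
\<close>

lemma dual_error_bound:
  fixes C :: "'v::finite \<Rightarrow> (real ^ 'm) set" and xbar :: "real ^ 'm"
  assumes C: "\<And>i. 0 \<in> C i"
    and ne: "normal_product C 0 \<inter> sum_constraint xbar \<noteq> ({} :: (real ^ 'm ^ 'v) set)"
    and first_order: "first_order_normals C 0"
    and cones_regular: "normal_cones_regular C xbar 0"
    and R: "0 < R"
  obtains \<epsilon> \<kappa> where "0 < \<epsilon>" "0 < \<kappa>"
    and "\<And>z x :: real ^ 'm ^ 'v. z + x \<in> sum_constraint xbar \<Longrightarrow>
           (\<And>i. z $ i \<in> normal_cone (C i) (x $ i)) \<Longrightarrow> norm z \<le> R \<Longrightarrow> norm x < \<epsilon> \<Longrightarrow>
           \<exists>zs\<in>normal_product C 0 \<inter> sum_constraint xbar. norm (z - zs) \<le> \<kappa> * norm x"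
proof -
  obtain U \<kappa>3 where U: "open U" "0 \<in> U" and \<kappa>3: "0 < \<kappa>3" and
    first: "\<And>i x z. x \<in> U \<Longrightarrow> x \<in> C i \<Longrightarrow> z \<in> normal_cone (C i) x \<Longrightarrow> z \<noteq> 0 \<Longrightarrow>
       \<exists>zr \<in> normal_cone (C i) 0 - {0}. norm (z /\<^sub>R norm z - zr /\<^sub>R norm zr) \<le> \<kappa>3 * norm x"
    using first_order unfolding first_order_normals_def by auto
  obtain \<epsilon> where \<epsilon>: "0 < \<epsilon>" "ball 0 \<epsilon> \<subseteq> U" using U openE by blast
  obtain \<kappa>4 where \<kappa>4: "0 < \<kappa>4" and
    reg: "\<And>z :: real ^ 'm ^ 'v. z \<in> normal_product C 0 \<Longrightarrow>
        infdist z (normal_product C 0 \<inter> sum_constraint xbar) \<le> \<kappa>4 * infdist z (sum_constraint xbar)"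
    using cones_regular unfolding normal_cones_regular_def by blast
  define k where "k = real CARD('v) * (\<kappa>3 * R)"
  have k: "0 \<le> k" using \<kappa>3 R by (simp add: k_def)
  show ?thesis
  proof (rule that[of \<epsilon> "k + \<kappa>4 * (k + 1)"])
    show "0 < k + \<kappa>4 * (k + 1)" using k \<kappa>4 by (simp add: add_nonneg_pos)
    fix z x :: "real ^ 'm ^ 'v"
    assume sum: "z + x \<in> sum_constraint xbar" and nc: "\<And>i. z $ i \<in> normal_cone (C i) (x $ i)"
      and zR: "norm z \<le> R" and x\<epsilon>: "norm x < \<epsilon>"
    have "\<exists>w\<in>normal_cone (C i) 0. norm (z $ i - w) \<le> \<kappa>3 * R * norm x" for i
    proof (cases "z $ i = 0")
      case True
      then show ?thesis
        using C[of i] \<kappa>3 R by (intro bexI[of _ 0]) (auto simp: normal_cone_def)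
    next
      case False
      have xi: "norm (x $ i) \<le> norm x" by (rule Finite_Cartesian_Product.norm_nth_le)
      then have "x $ i \<in> U" using x\<epsilon> \<epsilon>(2) by (auto simp: subset_iff)
      moreover have "x $ i \<in> C i" using nc[of i] by (simp add: normal_cone_def)
      ultimately obtain zr where zr: "zr \<in> normal_cone (C i) 0" "zr \<noteq> 0"
        "norm (z $ i /\<^sub>R norm (z $ i) - zr /\<^sub>R norm zr) \<le> \<kappa>3 * norm (x $ i)"
        using first[of "x $ i" i "z $ i"] nc[of i] False by auto
      define w where "w = (norm (z $ i) / norm zr) *\<^sub>R zr"
      have "z $ i - w = norm (z $ i) *\<^sub>R (z $ i /\<^sub>R norm (z $ i) - zr /\<^sub>R norm zr)"
        using False by (simp add: w_def scaleR_diff_right divide_inverse)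
      then have "norm (z $ i - w) \<le> norm (z $ i) * (\<kappa>3 * norm (x $ i))"
        using zr(3) by (simp add: mult_left_mono)
      also have "\<dots> \<le> R * (\<kappa>3 * norm x)"
        using order_trans[OF Finite_Cartesian_Product.norm_nth_le zR] xi \<kappa>3 R by (intro mult_mono) auto
      finally show ?thesis
        using normal_cone_scaleR[OF zr(1), of "norm (z $ i) / norm zr"]
        by (intro bexI[of _ w]) (auto simp: w_def mult_ac)
    qed
    then obtain w where w: "\<And>i. w i \<in> normal_cone (C i) 0"
      "\<And>i. norm (z $ i - w i) \<le> \<kappa>3 * R * norm x"
      by metis
    define zr where "zr = (\<chi> i. w i)"
    have zr: "zr \<in> normal_product C 0" using w(1) by (simp add: zr_def normal_product_def)
    have "norm (z - zr) \<le> (\<Sum>i\<in>UNIV. norm (z $ i - w i))"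
      unfolding norm_vec_def zr_def by (rule order_trans[OF L2_set_le_sum]) auto
    also have "\<dots> \<le> (\<Sum>i\<in>(UNIV::'v set). \<kappa>3 * R * norm x)" by (intro sum_mono w(2))
    also have "\<dots> = k * norm x" by (simp add: k_def)
    finally have d1: "norm (z - zr) \<le> k * norm x" .
    have "infdist zr (sum_constraint xbar) \<le> dist zr (z + x)" by (rule infdist_le[OF sum])
    also have "\<dots> \<le> norm (z - zr) + norm x"
      using norm_triangle_ineq[of "z - zr" x] by (simp add: dist_norm norm_minus_commute[of zr] algebra_simps)
    also have "\<dots> \<le> (k + 1) * norm x" using d1 by (simp add: algebra_simps)
    finally have d2: "infdist zr (sum_constraint xbar) \<le> (k + 1) * norm x" .
    obtain zs where zs: "zs \<in> normal_product C 0 \<inter> sum_constraint xbar"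
      "infdist zr (normal_product C 0 \<inter> sum_constraint xbar) = dist zr zs"
      using infdist_attains_inf[OF closed_Int[OF closed_normal_product[OF C] closed_sum_constraint] ne]
      by metis
    have "dist zr zs \<le> \<kappa>4 * ((k + 1) * norm x)"
      using reg[OF zr] zs(2) mult_left_mono[OF d2, of \<kappa>4] \<kappa>4 by linarith
    then have "norm (z - zs) \<le> (k + \<kappa>4 * (k + 1)) * norm x"
      using d1 norm_triangle_ineq[of "z - zr" "zr - zs"] by (simp add: dist_norm algebra_simps)
    then show "\<exists>zs\<in>normal_product C 0 \<inter> sum_constraint xbar.
        norm (z - zs) \<le> (k + \<kappa>4 * (k + 1)) * norm x"
      using zs(1) by blast
  qed (rule \<epsilon>(1))
qed

text \<open>
  With \<open>norm (z - zs)\<close> of the order of \<open>norm x\<close>, one factor \<open>norm x\<close> cancels in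
  \<open>duality_gap_bound\<close>, since \<open>z \<bullet> x\<close> is nonnegative. So \<open>norm x\<close> is of the order of the
  distance to consensus, and inserting this once more makes the value quadratic in that
  distance.
\<close>

lemma dual_value_quadratic_bound:
  fixes C :: "'v::finite \<Rightarrow> (real ^ 'm) set" and x z zs :: "real ^ 'm ^ 'v"
  assumes C: "\<And>i. 0 \<in> C i"
    and sum: "z + x \<in> sum_constraint xbar"
    and nc: "\<And>i. z $ i \<in> normal_cone (C i) (x $ i)"
    and zs: "zs \<in> normal_product C 0" "zs \<in> sum_constraint xbar"
    and close: "norm (z - zs) \<le> \<kappa> * norm x" and \<kappa>: "0 < \<kappa>"
  shows "z \<bullet> x + 1 / 2 * (norm x)\<^sup>2 \<le> (\<kappa> + 1)\<^sup>2 * (norm (x - (\<chi> i. c)))\<^sup>2"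
proof -
  define d where "d = norm (x - (\<chi> i. c))"
  have xC: "x $ i \<in> C i" for i using nc[of i] by (simp add: normal_cone_def)
  have "0 \<le> z $ i \<bullet> x $ i" for i
    using nc[of i] C[of i] by (force simp: normal_cone_def inner_diff_right)
  then have zx: "0 \<le> z \<bullet> x" unfolding inner_blocks by (intro sum_nonneg)
  have "z \<bullet> x + (norm x)\<^sup>2 \<le> norm (z - zs + x) * d"
    unfolding d_def by (rule duality_gap_bound[OF sum zs xC])
  also have "\<dots> \<le> ((\<kappa> + 1) * norm x) * d"
  proof (rule mult_right_mono)
    show "norm (z - zs + x) \<le> (\<kappa> + 1) * norm x"
      using norm_triangle_ineq[of "z - zs" x] close by (simp add: algebra_simps)
  qed (simp add: d_def)
  finally have gap: "z \<bullet> x + (norm x)\<^sup>2 \<le> (\<kappa> + 1) * norm x * d" .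
  have "norm x * norm x \<le> norm x * ((\<kappa> + 1) * d)"
    using gap zx by (simp add: power2_eq_square mult_ac)
  then have nx: "norm x \<le> (\<kappa> + 1) * d"
    using \<kappa> by (cases "x = 0") (auto simp: d_def)
  have "z \<bullet> x + 1 / 2 * (norm x)\<^sup>2 \<le> z \<bullet> x + (norm x)\<^sup>2" by simp
  also have "\<dots> \<le> ((\<kappa> + 1) * d) * norm x" using gap by (simp add: mult_ac)
  also have "\<dots> \<le> ((\<kappa> + 1) * d) * ((\<kappa> + 1) * d)"
    using nx \<kappa> by (intro mult_left_mono) (auto simp: d_def)
  finally show ?thesis by (simp add: d_def power2_eq_square mult_ac)
qed

section \<open>Convergence along a run\<close>

lemma support_fun_normal_cone:
  assumes "z \<in> normal_cone S x"
  shows "support_fun S z = ereal (z \<bullet> x)"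
proof (rule antisym)
  show "support_fun S z \<le> ereal (z \<bullet> x)"
    unfolding support_fun_le_iff using assms by (auto simp: normal_cone_def inner_diff_right)
  show "ereal (z \<bullet> x) \<le> support_fun S z"
    using assms by (intro inner_le_support_fun) (simp add: normal_cone_def)
qed

lemma block_dual_fun_finite:
  assumes C: "\<And>i. 0 \<in> C i"
    and fin: "\<And>\<alpha>. \<alpha> \<in> dual_index E \<Longrightarrow> support_fun (block_set C \<alpha>) (z \<alpha>) \<noteq> \<infinity>"
  obtains a where "block_dual_fun E C xbar z = ereal a"
    and "1 / 2 * (norm (primal_point E xbar z))\<^sup>2 \<le> a"
proof -
  have "\<exists>a\<ge>0. support_fun (block_set C \<alpha>) (z \<alpha>) = ereal a" if "\<alpha> \<in> dual_index E" for \<alpha>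
    using support_fun_finite[OF zero_in_block_set[OF C] fin[OF that]] by metis
  then obtain g where g: "\<And>\<alpha>. \<alpha> \<in> dual_index E \<Longrightarrow> 0 \<le> g \<alpha>"
    "\<And>\<alpha>. \<alpha> \<in> dual_index E \<Longrightarrow> support_fun (block_set C \<alpha>) (z \<alpha>) = ereal (g \<alpha>)"
    by metis
  show ?thesis
    by (rule that[of "1 / 2 * (norm (primal_point E xbar z))\<^sup>2 + (\<Sum>\<alpha>\<in>dual_index E. g \<alpha>)"])
      (simp_all add: block_dual_fun_def g sum_nonneg)
qed

text \<open>
  After the vertex step each support function is attained at the corresponding component of
  \<open>x\<close>, and finite edge terms vanish; so the dual value depends on the edge duals only
  through \<open>x\<close>. The edge duals also cancel from the sum of the components.
\<close>

lemma state_after_vertex_step: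
  fixes E :: "'v::finite set set" and C :: "'v \<Rightarrow> (real ^ 'm) set"
    and z :: "'v + 'v set \<Rightarrow> real ^ 'm ^ 'v" and xbar :: "real ^ 'm"
  defines "x \<equiv> primal_point E xbar z" and "\<zeta> \<equiv> (\<chi> i. z (Inl i) $ i)"
  assumes C: "\<And>i. 0 \<in> C i"
    and fin: "\<And>\<alpha>. \<alpha> \<in> dual_index E \<Longrightarrow> support_fun (block_set C \<alpha>) (z \<alpha>) \<noteq> \<infinity>"
    and nc: "\<And>i. z (Inl i) $ i \<in> normal_cone (C i) (x $ i)"
  shows "\<zeta> + x \<in> sum_constraint xbar"
    and "block_dual_fun E C xbar z = ereal (\<zeta> \<bullet> x + 1 / 2 * (norm x)\<^sup>2)"
proof -
  have off: "z (Inl i) $ j = 0" if "j \<noteq> i" for i j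
    by (rule vertex_block_support[OF C fin that]) (simp add: dual_index_def InlI)
  have edge: "z (Inr e) \<bullet> y = 0" if "e \<in> E" "y \<in> edge_space e" for e y
    using support_fun_subspace_orthogonal[OF subspace_edge_space] fin[of "Inr e"] that
    by (auto simp: dual_index_def)
  have vsum: "(\<Sum>i\<in>UNIV. z (Inl i)) = \<zeta>"
  proof (rule vec_eq_iff[THEN iffD2], rule allI)
    fix j
    have "(\<Sum>i\<in>UNIV. z (Inl i)) $ j = (\<Sum>i\<in>UNIV. if i = j then z (Inl i) $ j else 0)"
      unfolding sum_component by (intro sum.cong refl) (use off in auto)
    then show "(\<Sum>i\<in>UNIV. z (Inl i)) $ j = \<zeta> $ j" by (simp add: \<zeta>_def)
  qed
  have esum: "(\<Sum>i\<in>UNIV. z (Inr e) $ i) = 0" if e: "e \<in> E" for e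
  proof -
    define c where "c = (\<Sum>i\<in>UNIV. z (Inr e) $ i)"
    have "z (Inr e) \<bullet> (\<chi> i. c) = 0" by (rule edge[OF e]) (rule edge_spaceI, simp)
    then have "c \<bullet> c = 0" unfolding inner_blocks by (simp add: c_def inner_sum_left)
    then show ?thesis by (simp add: c_def)
  qed
  have "\<zeta> + x = (\<chi> i. xbar) - (\<Sum>e\<in>E. z (Inr e))"
    unfolding x_def primal_point_def dual_index_def by (simp add: sum.Plus vsum)
  moreover have "(\<Sum>i\<in>UNIV. ((\<chi> i. xbar) - (\<Sum>e\<in>E. z (Inr e))) $ i)
      = (\<Sum>i\<in>(UNIV::'v set). xbar) - (\<Sum>e\<in>E. \<Sum>i\<in>UNIV. z (Inr e) $ i)"
    by (subst sum.swap) (simp add: sum_subtractf sum_component)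
  ultimately show "\<zeta> + x \<in> sum_constraint xbar"
    unfolding sum_constraint_def by (simp add: esum sum_constant_scaleR del: sum_constant)
  have "support_fun (block_set C (Inl i)) (z (Inl i)) = ereal (\<zeta> $ i \<bullet> x $ i)" for i
    using support_fun_vertex_block[OF off, where C = C, of i i] support_fun_normal_cone[OF nc[of i]]
    by (simp add: \<zeta>_def)
  moreover have "support_fun (edge_space e) (z (Inr e)) = 0" if "e \<in> E" for e
    using edge that by (intro support_fun_orthogonal) (auto simp: subspace_0 subspace_edge_space)
  ultimately have "(\<Sum>\<alpha>\<in>dual_index E. support_fun (block_set C \<alpha>) (z \<alpha>)) = ereal (\<zeta> \<bullet> x)"
    unfolding dual_index_def inner_blocks by (simp add: sum.Plus)
  then show "block_dual_fun E C xbar z = ereal (\<zeta> \<bullet> x + 1 / 2 * (norm x)\<^sup>2)"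
    unfolding block_dual_fun_def x_def[symmetric] by (simp add: add.commute)
qed

locale dykstra_run =
  fixes E :: "'v::finite set set"
    and C :: "'v \<Rightarrow> (real ^ 'm) set"
    and xbar :: "real ^ 'm"
    and wbar :: nat
    and S :: "nat \<Rightarrow> nat \<Rightarrow> ('v + 'v set) set"
    and z :: "nat \<Rightarrow> nat \<Rightarrow> 'v + 'v set \<Rightarrow> real ^ 'm ^ 'v"
  assumes C: "\<And>i. closed (C i)" "\<And>i. convex (C i)" "\<And>i. 0 \<in> C i"
    and wbar: "1 \<le> wbar"
    and run: "distributed_dykstra E C xbar wbar S z"
    and covers: "\<And>\<alpha> n. \<alpha> \<in> dual_index E \<Longrightarrow> 1 \<le> n \<Longrightarrow> \<exists>w\<in>{1..wbar}. \<alpha> \<in> S n w"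
    and vertices_first: "\<And>n. 1 \<le> n \<Longrightarrow> S n 1 = range Inl"
begin

definition x :: "nat \<Rightarrow> nat \<Rightarrow> real ^ 'm ^ 'v" where
  "x n w = primal_point E xbar (z n w)"

text \<open>
  The initial vertex duals may have an infinite dual value, which \<open>real_of_ereal\<close> turns
  into \<open>0\<close>; from \<open>n = 2\<close> on all values are finite.
\<close>

definition val :: "nat \<Rightarrow> nat \<Rightarrow> real" where
  "val n w = real_of_ereal (block_dual_fun E C xbar (z n w))"

definition vertex_dual :: "nat \<Rightarrow> real ^ 'm ^ 'v" where
  "vertex_dual n = (\<chi> i. z n 1 (Inl i) $ i)"

lemma block_step:
  assumes "1 \<le> n" "1 \<le> w" "w \<le> wbar"
  shows "S n w \<subseteq> dual_index E"
    and "is_arg_min (block_objective E C xbar (S n w) (z n (w - 1))) (\<lambda>_. True) (z n w)"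
    and "\<And>\<alpha>. \<alpha> \<in> dual_index E - S n w \<Longrightarrow> z n w \<alpha> = z n (w - 1) \<alpha>"
  using run assms unfolding distributed_dykstra_def by (metis atLeastAtMost_iff)+

lemma next_cycle: "1 \<le> n \<Longrightarrow> \<alpha> \<in> dual_index E \<Longrightarrow> z (Suc n) 0 \<alpha> = z n wbar \<alpha>"
  using run unfolding distributed_dykstra_def by blast

lemma next_cycle_x: "1 \<le> n \<Longrightarrow> x (Suc n) 0 = x n wbar"
  by (simp add: x_def primal_point_def next_cycle)

lemma next_cycle_val: "1 \<le> n \<Longrightarrow> val (Suc n) 0 = val n wbar"
  using next_cycle_x by (simp add: val_def block_dual_fun_def next_cycle x_def)

text \<open>
  An update makes a block finite, and a block that is not updated keeps its value; so
  finiteness of the blocks is passed on from step to step.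
\<close>

lemma edge_blocks_finite_within_cycle:
  assumes "1 \<le> n" "\<And>e. e \<in> E \<Longrightarrow> support_fun (edge_space e) (z n 0 (Inr e)) \<noteq> \<infinity>"
    and "w \<le> wbar" "e \<in> E"
  shows "support_fun (edge_space e) (z n w (Inr e)) \<noteq> \<infinity>"
  using assms(3)
proof (induction w)
  case 0
  show ?case using assms(2,4) by simp
next
  case (Suc w)
  then have w: "1 \<le> Suc w" "Suc w \<le> wbar" by auto
  show ?case
  proof (cases "Inr e \<in> S n (Suc w)")
    case True
    from dykstra_step_finite[OF C block_step[OF assms(1) w] True] show ?thesis by simp
  next
    case False
    then have "z n (Suc w) (Inr e) = z n w (Inr e)"
      using block_step(3)[OF assms(1) w, of "Inr e"] assms(4) by (auto simp: dual_index_def)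
    then show ?thesis using Suc by simp
  qed
qed

lemma edge_blocks_finite:
  assumes "1 \<le> n" "w \<le> wbar" "e \<in> E"
  shows "support_fun (edge_space e) (z n w (Inr e)) \<noteq> \<infinity>"
  using assms
proof (induction n arbitrary: w e rule: dec_induct)
  case base
  show ?case
  proof (rule edge_blocks_finite_within_cycle[OF _ _ base])
    fix e assume "e \<in> E"
    then have "z 1 0 (Inr e) \<in> orthogonal_comp (edge_space e)"
      using run unfolding distributed_dykstra_def by blast
    then have "support_fun (edge_space e) (z 1 0 (Inr e)) = 0"
      by (intro support_fun_orthogonal)
        (auto simp: subspace_0 subspace_edge_space orthogonal_comp_def orthogonal_def inner_commute)
    then show "support_fun (edge_space e) (z 1 0 (Inr e)) \<noteq> \<infinity>" by simp
  qed simp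
next
  case (step n)
  show ?case
  proof (rule edge_blocks_finite_within_cycle[OF _ _ step.prems])
    fix e assume "e \<in> E"
    then show "support_fun (edge_space e) (z (Suc n) 0 (Inr e)) \<noteq> \<infinity>"
      using step.IH[of wbar e] next_cycle[OF step.hyps(1), of "Inr e"] by (simp add: dual_index_def InrI)
  qed simp
qed

text \<open>
  In contrast to the edge duals, the initial vertex duals carry no finiteness assumption;
  the vertex step that opens every cycle supplies it.
\<close>

lemma vertex_blocks_finite:
  assumes n: "1 \<le> n" and w: "1 \<le> w" "w \<le> wbar"
  shows "support_fun (block_set C (Inl i)) (z n w (Inl i)) \<noteq> \<infinity>"
  using w
proof (induction w rule: dec_induct)
  case base
  have "Inl i \<in> S n 1" using vertices_first[OF n] by simp
  from dykstra_step_finite[OF C block_step[OF n order_refl wbar] this] show ?case .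
next
  case (step w)
  then have w: "1 \<le> Suc w" "Suc w \<le> wbar" by auto
  show ?case
  proof (cases "Inl i \<in> S n (Suc w)")
    case True
    from dykstra_step_finite[OF C block_step[OF n w] True] show ?thesis .
  next
    case False
    then have "z n (Suc w) (Inl i) = z n w (Inl i)"
      using block_step(3)[OF n w, of "Inl i"] by (auto simp: dual_index_def)
    then show ?thesis using step by simp
  qed
qed

lemma blocks_finite:
  assumes "1 \<le> n" "1 \<le> w" "w \<le> wbar" "\<alpha> \<in> dual_index E"
  shows "support_fun (block_set C \<alpha>) (z n w \<alpha>) \<noteq> \<infinity>"
  using assms vertex_blocks_finite edge_blocks_finite by (cases \<alpha>) (auto simp: dual_index_def)

lemma blocks_finite_start:
  assumes "2 \<le> n" "\<alpha> \<in> dual_index E"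
  shows "support_fun (block_set C \<alpha>) (z n 0 \<alpha>) \<noteq> \<infinity>"
proof -
  obtain m where m: "n = Suc m" "1 \<le> m" using assms(1) by (cases n) auto
  show ?thesis using blocks_finite[OF m(2) wbar order_refl assms(2)] next_cycle[OF m(2) assms(2)] m(1) by simp
qed

lemma val:
  assumes "2 \<le> n" "w \<le> wbar"
  shows "block_dual_fun E C xbar (z n w) = ereal (val n w)"
    and "1 / 2 * (norm (x n w))\<^sup>2 \<le> val n w"
proof -
  have fin: "support_fun (block_set C \<alpha>) (z n w \<alpha>) \<noteq> \<infinity>" if "\<alpha> \<in> dual_index E" for \<alpha>
    using blocks_finite[of n w] blocks_finite_start[of n] assms that by (cases "w = 0") auto
  obtain a where "block_dual_fun E C xbar (z n w) = ereal a"
    "1 / 2 * (norm (primal_point E xbar (z n w)))\<^sup>2 \<le> a"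
    by (rule block_dual_fun_finite[OF C(3) fin])
  then show "block_dual_fun E C xbar (z n w) = ereal (val n w)"
    and "1 / 2 * (norm (x n w))\<^sup>2 \<le> val n w" by (simp_all add: val_def x_def)
qed

lemma dual_fun_val:
  assumes "2 \<le> n"
  shows "dual_fun E C xbar (z n 0) = ereal (val n 0)"
proof -
  have "z n 0 (Inl i) $ j = 0" if "j \<noteq> i" for i j
    by (rule vertex_block_support[OF C(3) blocks_finite_start[OF assms] that])
      (simp add: dual_index_def InlI)
  then have "dual_fun E C xbar (z n 0) = block_dual_fun E C xbar (z n 0)"
    by (rule dual_fun_eq_block_dual_fun)
  then show ?thesis using val(1)[OF assms, of 0] by simp
qed

lemma val_nonneg: "2 \<le> n \<Longrightarrow> w \<le> wbar \<Longrightarrow> 0 \<le> val n w"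
  by (rule order_trans[OF _ val(2)]) simp_all

lemma val_descent:
  assumes "2 \<le> n" "Suc w \<le> wbar"
  shows "val n (Suc w) + 1 / 2 * (norm (x n (Suc w) - x n w))\<^sup>2 \<le> val n w"
proof -
  have n: "1 \<le> n" and w: "1 \<le> Suc w" using assms by auto
  from dykstra_step_descent[OF C block_step[OF n w assms(2)]]
  show ?thesis using val(1)[OF assms] val(1)[of n w] assms by (simp add: x_def)
qed

lemma val_antimono:
  assumes "2 \<le> n" "w \<le> w'" "w' \<le> wbar"
  shows "val n w' \<le> val n w"
  using assms(2,3)
proof (induction w' rule: dec_induct)
  case (step v)
  then have "val n (Suc v) + 1 / 2 * (norm (x n (Suc v) - x n v))\<^sup>2 \<le> val n v"
    by (intro val_descent assms(1)) auto
  moreover have "0 \<le> 1 / 2 * (norm (x n (Suc v) - x n v))\<^sup>2" by simp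
  ultimately show ?case using step by linarith
qed simp

lemma val_chain:
  assumes "2 \<le> n"
  shows "val (Suc n) 0 \<le> val n 1" "val n 1 \<le> val n 0"
  using val_antimono[OF assms, of 1 wbar] val_antimono[OF assms, of 0 1] next_cycle_val[of n] assms wbar
  by auto

lemma val_start_antimono:
  assumes "2 \<le> m" "m \<le> n"
  shows "val n 0 \<le> val m 0"
  using assms(2)
proof (induction n rule: dec_induct)
  case (step n)
  then show ?case using val_chain[of n] assms(1) by simp
qed simp

lemma first_state:
  assumes "2 \<le> n"
  shows "vertex_dual n + x n 1 \<in> sum_constraint xbar"
    and "\<And>i. vertex_dual n $ i \<in> normal_cone (C i) (x n 1 $ i)"
    and "val n 1 = vertex_dual n \<bullet> x n 1 + 1 / 2 * (norm (x n 1))\<^sup>2"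
proof -
  have n: "1 \<le> n" using assms by simp
  have nc: "z n 1 (Inl i) $ i \<in> normal_cone (C i) (primal_point E xbar (z n 1) $ i)" for i
    using dykstra_step_vertex[OF C block_step[OF n order_refl wbar]] vertices_first[OF n] by blast
  then show "\<And>i. vertex_dual n $ i \<in> normal_cone (C i) (x n 1 $ i)"
    by (simp add: vertex_dual_def x_def)
  note state = state_after_vertex_step[OF C(3) blocks_finite[OF n order_refl wbar] nc]
  show "vertex_dual n + x n 1 \<in> sum_constraint xbar"
    using state(1) by (simp add: vertex_dual_def x_def)
  show "val n 1 = vertex_dual n \<bullet> x n 1 + 1 / 2 * (norm (x n 1))\<^sup>2"
    using state(2) by (simp add: vertex_dual_def x_def val_def)
qed

lemma inner_vertex_dual_le_val:
  assumes "2 \<le> n" "\<And>i. a $ i \<in> C i"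
  shows "vertex_dual n \<bullet> a \<le> val n 1"
proof -
  have "vertex_dual n \<bullet> a \<le> vertex_dual n \<bullet> x n 1"
    unfolding inner_blocks
    using first_state(2)[OF assms(1)] assms(2)
    by (intro sum_mono) (auto simp: normal_cone_def inner_diff_right)
  moreover have "0 \<le> 1 / 2 * (norm (x n 1))\<^sup>2" by simp
  ultimately show ?thesis using first_state(3)[OF assms(1)] by linarith
qed

text \<open>
  Each single step moves \<open>x\<close> by at most \<open>sqrt (2 * D)\<close>, where \<open>D\<close> is the decrease of the dual
  value over the rest of the cycle, because the decreases of the steps add up to \<open>D\<close>.
\<close>

lemma drift_within_cycle:
  assumes n: "2 \<le> n" and w: "1 \<le> w" "w \<le> wbar"
  shows "norm (x n w - x n 1) \<le> real w * sqrt (2 * (val n 1 - val (Suc n) 0))"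
  using w
proof (induction w rule: dec_induct)
  case base
  show ?case using val_chain[OF n] by simp
next
  case (step w)
  define D where "D = val n 1 - val (Suc n) 0"
  have "val n (Suc w) + 1 / 2 * (norm (x n (Suc w) - x n w))\<^sup>2 \<le> val n w"
    using step by (intro val_descent n) auto
  moreover have "val n w \<le> val n 1" "val n wbar \<le> val n (Suc w)"
    using step by (auto intro!: val_antimono n)
  ultimately have "(norm (x n (Suc w) - x n w))\<^sup>2 \<le> 2 * D"
    using next_cycle_val[of n] n by (simp add: D_def)
  then have "norm (x n (Suc w) - x n w) \<le> sqrt (2 * D)" by (rule real_le_rsqrt)
  moreover have "norm (x n w - x n 1) \<le> real w * sqrt (2 * D)"
    using step by (simp add: D_def)
  ultimately show ?case
    unfolding D_def[symmetric] of_nat_Suc distrib_right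
    using norm_triangle_ineq[of "x n (Suc w) - x n w" "x n w - x n 1"] by simp
qed

text \<open>
  At the step in which the edge is treated the two components agree, and neither of them
  has moved far since the vertex step.
\<close>

lemma neighbours_close:
  assumes n: "2 \<le> n" and ij: "{i, j} \<in> E"
  shows "norm (x n 1 $ i - x n 1 $ j) \<le> 2 * (real wbar * sqrt (2 * (val n 1 - val (Suc n) 0)))"
proof -
  have n1: "1 \<le> n" using n by simp
  obtain w where w: "1 \<le> w" "w \<le> wbar" "Inr {i, j} \<in> S n w"
    using covers[of "Inr {i, j}" n] ij n1 by (auto simp: dual_index_def InrI)
  have "x n w \<in> edge_space {i, j}"
    unfolding x_def using dykstra_step_edge[OF C block_step[OF n1 w(1,2)] w(3)] .
  then have eq: "x n w $ i = x n w $ j" by (rule edge_space_eqD) auto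
  define b where "b = real wbar * sqrt (2 * (val n 1 - val (Suc n) 0))"
  have "norm (x n w - x n 1) \<le> real w * sqrt (2 * (val n 1 - val (Suc n) 0))"
    by (rule drift_within_cycle[OF n w(1,2)])
  also have "\<dots> \<le> b"
    unfolding b_def using w(2) val_chain[OF n] by (intro mult_right_mono) auto
  finally have b: "norm ((x n w - x n 1) $ k) \<le> b" for k
    using Finite_Cartesian_Product.norm_nth_le order_trans by blast
  have "x n 1 $ i - x n 1 $ j = (x n w - x n 1) $ j - (x n w - x n 1) $ i"
    using eq by simp
  then show ?thesis
    using norm_triangle_ineq4[of "(x n w - x n 1) $ j" "(x n w - x n 1) $ i"] b[of i] b[of j]
    unfolding b_def[symmetric] by simp
qed

lemma consensus_error:
  assumes "connected_graph E"
  obtains L where "0 < L"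
    and "\<And>n i. 2 \<le> n \<Longrightarrow>
           (norm (x n 1 - (\<chi> j. x n 1 $ i)))\<^sup>2 \<le> L * (val n 1 - val (Suc n) 0)"
proof -
  obtain k where k: "0 < k"
    and var: "\<And>(y :: real ^ 'm ^ 'v) \<delta> i. 0 \<le> \<delta> \<Longrightarrow>
           (\<And>i j. {i, j} \<in> E \<Longrightarrow> norm (y $ i - y $ j) \<le> \<delta>) \<Longrightarrow>
           norm (y - (\<chi> j. y $ i)) \<le> k * \<delta>"
    using connected_graph_variation[OF assms] by metis
  show ?thesis
  proof (rule that[of "8 * (k * real wbar)\<^sup>2"])
    show "0 < 8 * (k * real wbar)\<^sup>2" using k wbar by simp
    fix n :: nat and i assume n: "2 \<le> n"
    define D where "D = val n 1 - val (Suc n) 0"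
    have D: "0 \<le> D" using val_chain[OF n] by (simp add: D_def)
    have "norm (x n 1 - (\<chi> j. x n 1 $ i)) \<le> k * (2 * (real wbar * sqrt (2 * D)))"
      using D neighbours_close[OF n] by (intro var) (auto simp: D_def)
    then have "(norm (x n 1 - (\<chi> j. x n 1 $ i)))\<^sup>2 \<le> (k * (2 * (real wbar * sqrt (2 * D))))\<^sup>2"
      by (intro power_mono) auto
    also have "\<dots> = 8 * (k * real wbar)\<^sup>2 * D"
      using D by (simp add: power_mult_distrib)
    finally show "(norm (x n 1 - (\<chi> j. x n 1 $ i)))\<^sup>2
        \<le> 8 * (k * real wbar)\<^sup>2 * (val n 1 - val (Suc n) 0)" by (simp add: D_def)
  qed
qed

lemma vertex_duals_bounded:
  assumes "zs \<in> normal_product C 0 \<inter> sum_constraint xbar"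
    and "bounded (normal_product C 0 \<inter> sum_constraint xbar :: (real ^ 'm ^ 'v) set)"
  obtains R where "0 < R" "\<And>n. 2 \<le> n \<Longrightarrow> norm (vertex_dual n) \<le> R"
    "\<And>n. 2 \<le> n \<Longrightarrow> norm (x n 1) \<le> R"
proof -
  \<comment> \<open>one constant that bounds both the dual values and, through \<open>\<parallel>x\<parallel>\<^sup>2 / 2\<close>, the primal points\<close>
  define c where "c = max (val 2 0) (sqrt (2 * val 2 0))"
  have le: "val n 1 \<le> val 2 0" if "2 \<le> n" for n
    using val_chain[OF that] val_start_antimono[OF _ that] by simp
  have xc: "norm (x n 1) \<le> c" if n: "2 \<le> n" for n
  proof -
    have "(norm (x n 1))\<^sup>2 \<le> 2 * val 2 0" using val(2)[OF n wbar] le[OF n] by simp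
    then show ?thesis unfolding c_def by (simp add: real_le_rsqrt le_max_iff_disj)
  qed
  obtain R where R: "0 < R"
    "\<And>z x. z + x \<in> sum_constraint xbar \<Longrightarrow> norm x \<le> c \<Longrightarrow>
           (\<And>a. (\<And>i. a $ i \<in> C i) \<Longrightarrow> z \<bullet> a \<le> c) \<Longrightarrow> norm (z :: real ^ 'm ^ 'v) \<le> R"
    using dual_level_set_bounded[OF C(3) assms, of c] by metis
  have zR: "norm (vertex_dual n) \<le> R" if n: "2 \<le> n" for n
  proof (rule R(2)[OF first_state(1)[OF n] xc[OF n]])
    fix a :: "real ^ 'm ^ 'v" assume "\<And>i. a $ i \<in> C i"
    then have "vertex_dual n \<bullet> a \<le> val n 1" by (rule inner_vertex_dual_le_val[OF n])
    also have "\<dots> \<le> c" using le[OF n] by (simp add: c_def)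
    finally show "vertex_dual n \<bullet> a \<le> c" .
  qed
  show ?thesis
  proof (rule that[of "max R c"])
    show "0 < max R c" using R(1) by simp
  qed (use zR xc in \<open>auto simp: le_max_iff_disj\<close>)
qed

text \<open>
  The dual values are decreasing and nonnegative, hence convergent.
\<close>

lemma val_decrements_tendsto_zero: "(\<lambda>n. val n 1 - val (Suc n) 0) \<longlonglongrightarrow> 0"
proof -
  have "decseq (\<lambda>n. val (n + 2) 0)"
    by (intro decseq_SucI) (simp add: val_start_antimono)
  moreover have "\<forall>n. 0 \<le> val (n + 2) 0" by (simp add: val_nonneg)
  ultimately obtain L where L: "(\<lambda>n. val (n + 2) 0) \<longlonglongrightarrow> L"
    using decseq_convergent[of "\<lambda>n. val (n + 2) 0" 0] by blast
  then have L0: "(\<lambda>n. val n 0) \<longlonglongrightarrow> L" by (rule LIMSEQ_offset)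
  have "(\<lambda>n. val n 0 - val (Suc n) 0) \<longlonglongrightarrow> L - L"
    by (intro tendsto_diff L0 LIMSEQ_Suc)
  then have lim: "(\<lambda>n. val n 0 - val (Suc n) 0) \<longlonglongrightarrow> 0" by simp
  show ?thesis
  proof (rule tendsto_sandwich[OF _ _ tendsto_const lim])
    show "\<forall>\<^sub>F n in sequentially. 0 \<le> val n 1 - val (Suc n) 0"
      "\<forall>\<^sub>F n in sequentially. val n 1 - val (Suc n) 0 \<le> val n 0 - val (Suc n) 0"
      by (rule eventually_mono[OF eventually_ge_at_top[of 2]], use val_chain in simp)+
  qed
qed

text \<open>
  In \<open>duality_gap_bound\<close> with a fixed dual optimum the first factor stays bounded, and the
  distance to consensus tends to zero with the decrements of the dual value.
\<close>

lemma iterates_tendsto_zero: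
  assumes conn: "connected_graph E"
    and zs: "zs \<in> normal_product C 0 \<inter> sum_constraint xbar"
    and bdd: "bounded (normal_product C 0 \<inter> sum_constraint xbar :: (real ^ 'm ^ 'v) set)"
  shows "(\<lambda>n. norm (x n 1)) \<longlonglongrightarrow> 0"
proof -
  obtain R where R: "0 < R" "\<And>n. 2 \<le> n \<Longrightarrow> norm (vertex_dual n) \<le> R"
    "\<And>n. 2 \<le> n \<Longrightarrow> norm (x n 1) \<le> R"
    using vertex_duals_bounded[OF zs bdd] by metis
  obtain L where L: "0 < L" "\<And>n i. 2 \<le> n \<Longrightarrow>
           (norm (x n 1 - (\<chi> j. x n 1 $ i)))\<^sup>2 \<le> L * (val n 1 - val (Suc n) 0)"
    using consensus_error[OF conn] by metis
  define B where "B = R + norm zs + R"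
  have bound: "norm ((norm (x n 1))\<^sup>2) \<le> B * sqrt (L * (val n 1 - val (Suc n) 0))" if n: "2 \<le> n" for n
  proof -
    \<comment> \<open>an arbitrary vertex, whose component serves as the consensus value\<close>
    fix i :: 'v
    have xC: "x n 1 $ i \<in> C i" for i
      using first_state(2)[OF n, of i] by (simp add: normal_cone_def)
    have "0 \<le> vertex_dual n \<bullet> x n 1"
      unfolding inner_blocks
    proof (rule sum_nonneg)
      fix i :: 'v
      show "0 \<le> vertex_dual n $ i \<bullet> x n 1 $ i"
        using first_state(2)[OF n, of i] C(3)[of i] by (force simp: normal_cone_def inner_diff_right)
    qed
    then have "(norm (x n 1))\<^sup>2 \<le> vertex_dual n \<bullet> x n 1 + (norm (x n 1))\<^sup>2" by simp
    also have "\<dots> \<le> norm (vertex_dual n - zs + x n 1) * norm (x n 1 - (\<chi> j. x n 1 $ i))"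
      by (rule duality_gap_bound[OF first_state(1)[OF n] _ _ xC]) (use zs in auto)
    also have "\<dots> \<le> B * sqrt (L * (val n 1 - val (Suc n) 0))"
    proof (rule mult_mono)
      show "norm (vertex_dual n - zs + x n 1) \<le> B"
        using norm_triangle_ineq[of "vertex_dual n - zs" "x n 1"]
          norm_triangle_ineq4[of "vertex_dual n" zs] R(2,3)[OF n] by (simp add: B_def)
      show "norm (x n 1 - (\<chi> j. x n 1 $ i)) \<le> sqrt (L * (val n 1 - val (Suc n) 0))"
        by (rule real_le_rsqrt[OF L(2)[OF n]])
    qed (use R(1) in \<open>auto simp: B_def\<close>)
    finally show ?thesis by simp
  qed
  have "(\<lambda>n. B * sqrt (L * (val n 1 - val (Suc n) 0))) \<longlonglongrightarrow> B * sqrt (L * 0)"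
    by (intro tendsto_intros val_decrements_tendsto_zero)
  then have lim: "(\<lambda>n. B * sqrt (L * (val n 1 - val (Suc n) 0))) \<longlonglongrightarrow> 0" by simp
  have "(\<lambda>n. (norm (x n 1))\<^sup>2) \<longlonglongrightarrow> 0"
    by (rule Lim_null_comparison[OF eventually_mono[OF eventually_ge_at_top[of 2] bound] lim])
  then have "(\<lambda>n. sqrt ((norm (x n 1))\<^sup>2)) \<longlonglongrightarrow> sqrt 0" by (rule tendsto_real_sqrt)
  then show ?thesis by simp
qed

text \<open>
  From some cycle on, \<open>dual_value_quadratic_bound\<close> is available right after the vertex step,
  and \<open>consensus_error\<close> bounds the squared distance to consensus by the decrease of the dual
  value over the same cycle.
\<close>

lemma val_bounded_by_decrease:
  assumes conn: "connected_graph E"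
    and reg: "sets_regular E C xbar 0"
    and ne: "normal_product C 0 \<inter> sum_constraint xbar \<noteq> ({} :: (real ^ 'm ^ 'v) set)"
    and first_order: "first_order_normals C 0"
    and cones_regular: "normal_cones_regular C xbar 0"
  obtains K where "0 < K"
    and "\<forall>\<^sub>F n in sequentially. val (Suc n) 0 \<le> K * (val n 0 - val (Suc n) 0)"
proof -
  note bdd = dual_optimal_set_bounded[OF reg conn]
  obtain zs0 :: "real ^ 'm ^ 'v" where zs0: "zs0 \<in> normal_product C 0 \<inter> sum_constraint xbar"
    using ne by blast
  obtain R where R: "0 < R" "\<And>n. 2 \<le> n \<Longrightarrow> norm (vertex_dual n) \<le> R"
    using vertex_duals_bounded[OF zs0 bdd] by metis
  obtain L where L: "0 < L" "\<And>n i. 2 \<le> n \<Longrightarrow>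
           (norm (x n 1 - (\<chi> j. x n 1 $ i)))\<^sup>2 \<le> L * (val n 1 - val (Suc n) 0)"
    using consensus_error[OF conn] by metis
  obtain \<epsilon> \<kappa> where \<epsilon>: "0 < \<epsilon>" and \<kappa>: "0 < \<kappa>"
    and near: "\<And>z x :: real ^ 'm ^ 'v. z + x \<in> sum_constraint xbar \<Longrightarrow>
           (\<And>i. z $ i \<in> normal_cone (C i) (x $ i)) \<Longrightarrow> norm z \<le> R \<Longrightarrow> norm x < \<epsilon> \<Longrightarrow>
           \<exists>zs\<in>normal_product C 0 \<inter> sum_constraint xbar. norm (z - zs) \<le> \<kappa> * norm x"
    using dual_error_bound[OF C(3) ne first_order cones_regular R(1)] by metis
  define K where "K = (\<kappa> + 1)\<^sup>2 * L"
  show ?thesis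
  proof (rule that[of K])
    show "0 < K" using \<kappa> L(1) by (simp add: K_def)
    have "\<forall>\<^sub>F n in sequentially. norm (x n 1) < \<epsilon>"
      using order_tendstoD(2)[OF iterates_tendsto_zero[OF conn zs0 bdd] \<epsilon>] .
    then show "\<forall>\<^sub>F n in sequentially. val (Suc n) 0 \<le> K * (val n 0 - val (Suc n) 0)"
      using eventually_ge_at_top[of 2]
    proof eventually_elim
      case (elim n)
      note st = first_state[OF elim(2)]
      obtain zs where zs: "zs \<in> normal_product C 0" "zs \<in> sum_constraint xbar"
        "norm (vertex_dual n - zs) \<le> \<kappa> * norm (x n 1)"
        using near[OF st(1,2) R(2)[OF elim(2)] elim(1)] by blast
      \<comment> \<open>an arbitrary vertex, whose component serves as the consensus value\<close>
      fix i :: 'v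
      have "val n 1 \<le> (\<kappa> + 1)\<^sup>2 * (norm (x n 1 - (\<chi> j. x n 1 $ i)))\<^sup>2"
        unfolding st(3) by (rule dual_value_quadratic_bound[OF C(3) st(1,2) zs \<kappa>])
      also have "\<dots> \<le> (\<kappa> + 1)\<^sup>2 * (L * (val n 1 - val (Suc n) 0))"
        by (intro mult_left_mono L(2) elim) simp
      also have "\<dots> = K * (val n 1 - val (Suc n) 0)" by (simp add: K_def)
      also have "\<dots> \<le> K * (val n 0 - val (Suc n) 0)"
        using val_chain[OF elim(2)] \<open>0 < K\<close> by (intro mult_left_mono) auto
      finally show ?case using val_chain[OF elim(2)] by simp
    qed
  qed
qed

end

section \<open>Linear convergence\<close>

lemma contraction_if_bounded_by_decrease:
  fixes a b K :: real
  assumes "0 < K" "b \<le> K * (a - b)"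
  shows "b \<le> K / (1 + K) * a"
proof -
  have "b * (1 + K) \<le> K * a" using assms(2) by (simp add: algebra_simps)
  then show ?thesis using assms(1) by (simp add: field_simps)
qed

lemma linear_convergence_if_eventual_contraction:
  fixes a b :: "nat \<Rightarrow> real"
  assumes r: "0 < r" "r < 1"
    and a: "\<forall>\<^sub>F n in sequentially. a (Suc n) \<le> r * a n"
    and b: "\<forall>\<^sub>F n in sequentially. (b n)\<^sup>2 \<le> a n"
  shows "\<exists>K>0. \<exists>\<rho>. 0 < \<rho> \<and> \<rho> < 1 \<and> (\<forall>n. b n \<le> K * \<rho> ^ n)"
proof -
  from a b obtain N where N: "\<And>n. N \<le> n \<Longrightarrow> a (Suc n) \<le> r * a n" "\<And>n. N \<le> n \<Longrightarrow> (b n)\<^sup>2 \<le> a n"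
    using eventually_conj[OF a b] unfolding eventually_sequentially by blast
  define \<rho> where "\<rho> = sqrt r"
  have \<rho>: "0 < \<rho>" "\<rho> < 1" "\<rho>\<^sup>2 = r" using r by (auto simp: \<rho>_def)
  have geo: "a n \<le> r ^ (n - N) * a N" if "N \<le> n" for n
    using that
  proof (induction n rule: dec_induct)
    case (step n)
    have "a (Suc n) \<le> r * a n" using N(1) step by simp
    also have "\<dots> \<le> r * (r ^ (n - N) * a N)" using step r by (intro mult_left_mono) auto
    also have "\<dots> = r ^ (Suc n - N) * a N" using step by (simp add: Suc_diff_le)
    finally show ?case .
  qed simp
  have aN: "0 \<le> a N" using N(2)[of N] zero_le_power2[of "b N"] by linarith
  \<comment> \<open>the second summand covers the tail from \<open>N\<close> on, the sum the finitely many earlier indices,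
    and the \<open>1\<close> makes \<open>K\<close> positive\<close>
  define K where "K = 1 + sqrt (a N) / \<rho> ^ N + (\<Sum>m<N. \<bar>b m\<bar> / \<rho> ^ m)"
  have parts: "0 \<le> sqrt (a N) / \<rho> ^ N" "0 \<le> (\<Sum>m<N. \<bar>b m\<bar> / \<rho> ^ m)"
    using aN \<rho> by (auto intro!: sum_nonneg)
  have "b n \<le> K * \<rho> ^ n" for n
  proof (cases "n < N")
    case True
    have "\<bar>b n\<bar> / \<rho> ^ n \<le> (\<Sum>m<N. \<bar>b m\<bar> / \<rho> ^ m)"
      by (rule member_le_sum) (use True \<rho> in auto)
    then have "\<bar>b n\<bar> / \<rho> ^ n \<le> K" using parts by (simp add: K_def)
    then show ?thesis using \<rho>(1) by (simp add: pos_divide_le_eq)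
  next
    case False
    then have n: "N \<le> n" by simp
    have "(b n)\<^sup>2 \<le> r ^ (n - N) * a N" using N(2)[OF n] geo[OF n] by linarith
    also have "\<dots> = (\<rho> ^ (n - N) * sqrt (a N))\<^sup>2"
      using aN \<rho>(3) by (simp add: power_mult_distrib power_mult[symmetric] mult.commute[of _ 2])
        (simp add: power_mult)
    finally have "b n \<le> \<rho> ^ (n - N) * sqrt (a N)"
      by (rule power2_le_imp_le) (use aN \<rho> in simp)
    also have "\<dots> = (sqrt (a N) / \<rho> ^ N) * \<rho> ^ n"
      using \<rho>(1) n by (simp add: power_diff)
    also have "\<dots> \<le> K * \<rho> ^ n"
      using parts \<rho>(1) by (intro mult_right_mono) (auto simp: K_def)
    finally show ?thesis .
  qed
  moreover have "0 < K" using parts by (simp add: K_def)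
  ultimately show ?thesis using \<rho> by blast
qed

theorem theorem3p1:
  fixes E :: "'v::finite set set"
    and C :: "'v \<Rightarrow> (real ^ 'm) set"
    and xb :: "'v \<Rightarrow> real ^ 'm"
    and xbar xs :: "real ^ 'm"
    and wbar :: nat
    and S :: "nat \<Rightarrow> nat \<Rightarrow> ('v + 'v set) set"
    and z :: "nat \<Rightarrow> nat \<Rightarrow> 'v + 'v set \<Rightarrow> real ^ 'm ^ 'v"
  assumes edges: "\<And>e. e \<in> E \<Longrightarrow> card e = 2"
    and sets: "\<And>i. closed (C i)" "\<And>i. convex (C i)"
    and opt: "primal_solution C xb xs"
    and A1: "xs = 0"
    and A2: "\<And>i. xb i = xbar"
    and A3: "\<exists>\<zeta>. (\<forall>i. \<zeta> i \<in> normal_cone (C i) xs) \<and>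
                 (\<Sum>i\<in>UNIV. \<zeta> i) = real CARD('v) *\<^sub>R xbar"
    and A4: "sets_regular E C xbar xs"
    and A5: "connected_graph E"
    and A6: "semismooth_order2 C xs"
    and A7: "first_order_normals C xs"
    and A8: "normal_cones_regular C xbar xs"
    and wbar: "1 \<le> wbar"
    and dykstra: "distributed_dykstra E C xbar wbar S z"
    and B1: "\<And>\<alpha> n. \<alpha> \<in> dual_index E \<Longrightarrow> 1 \<le> n \<Longrightarrow> \<exists>w\<in>{1..wbar}. \<alpha> \<in> S n w"
    and B2: "\<And>n. 1 \<le> n \<Longrightarrow> S n 1 = range Inl"
  shows "(\<exists>r. 0 < r \<and> r < 1 \<and>
            (\<forall>\<^sub>F n in sequentially.
               dual_fun E C xbar (z (n + 1) 0) \<le> ereal r * dual_fun E C xbar (z (n - 1) 0)))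
       \<and> (\<forall>i. \<exists>K>0. \<exists>\<rho>. 0 < \<rho> \<and> \<rho> < 1 \<and>
            (\<forall>n\<ge>1. norm (primal_point E xbar (z n 0) $ i - xs) \<le> K * \<rho> ^ n))"
proof -
  obtain \<zeta> where \<zeta>: "\<And>i. \<zeta> i \<in> normal_cone (C i) 0"
    "(\<Sum>i\<in>UNIV. \<zeta> i) = real CARD('v) *\<^sub>R xbar"
    using A3 A1 by blast
  have C0: "0 \<in> C i" for i using \<zeta>(1)[of i] by (simp add: normal_cone_def)
  interpret dykstra_run E C xbar wbar S z
    by unfold_locales (use sets C0 wbar dykstra B1 B2 in auto)
  have "(\<chi> i. \<zeta> i) \<in> normal_product C 0 \<inter> sum_constraint xbar"
    using \<zeta> by (simp add: normal_product_def sum_constraint_def)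
  then have ne: "normal_product C 0 \<inter> sum_constraint xbar \<noteq> ({} :: (real ^ 'm ^ 'v) set)" by blast
  obtain K where K: "0 < K"
    and dec: "\<forall>\<^sub>F n in sequentially. val (Suc n) 0 \<le> K * (val n 0 - val (Suc n) 0)"
    using val_bounded_by_decrease[OF A5 _ ne] A4 A7 A8 A1 by blast
  define r where "r = K / (1 + K)"
  have r: "0 < r" "r < 1" using K by (auto simp: r_def)
  have contr: "\<forall>\<^sub>F n in sequentially. val (Suc n) 0 \<le> r * val n 0"
    using dec unfolding r_def
    by eventually_elim (rule contraction_if_bounded_by_decrease[OF K])
  have "\<forall>\<^sub>F n in sequentially.
      dual_fun E C xbar (z (n + 1) 0) \<le> ereal r * dual_fun E C xbar (z (n - 1) 0)"
    \<comment> \<open>\<open>n \<ge> 3\<close> makes the value at \<open>n - 1\<close> finite\<close>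
    using contr eventually_ge_at_top[of 3]
  proof eventually_elim
    case (elim n)
    have "val n 0 \<le> val (n - 1) 0" using elim(2) by (intro val_start_antimono) auto
    then have "r * val n 0 \<le> r * val (n - 1) 0" using r(1) by simp
    then have "val (n + 1) 0 \<le> r * val (n - 1) 0" using elim(1) by simp
    then show ?case using dual_fun_val[of "n + 1"] dual_fun_val[of "n - 1"] elim(2) by simp
  qed
  moreover have "\<exists>K>0. \<exists>\<rho>. 0 < \<rho> \<and> \<rho> < 1 \<and>
      (\<forall>n\<ge>1. norm (primal_point E xbar (z n 0) $ i - xs) \<le> K * \<rho> ^ n)" for i
  proof -
    have "\<forall>\<^sub>F n in sequentially. (norm (x n 0 $ i))\<^sup>2 \<le> 2 * val n 0"
      using eventually_ge_at_top[of 2]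
    proof eventually_elim
      case (elim n)
      have "(norm (x n 0 $ i))\<^sup>2 \<le> (norm (x n 0))\<^sup>2"
        by (intro power_mono Finite_Cartesian_Product.norm_nth_le) simp
      with val(2)[OF elim, of 0] show ?case by linarith
    qed
    moreover have "\<forall>\<^sub>F n in sequentially. 2 * val (Suc n) 0 \<le> r * (2 * val n 0)"
      using contr by eventually_elim simp
    ultimately obtain K \<rho> where "0 < K" "0 < \<rho>" "\<rho> < 1" "\<And>n. norm (x n 0 $ i) \<le> K * \<rho> ^ n"
      using linear_convergence_if_eventual_contraction
        [OF r, of "\<lambda>n. 2 * val n 0" "\<lambda>n. norm (x n 0 $ i)"] by blast
    then show ?thesis unfolding x_def A1 diff_zero by blast
  qed
  ultimately show ?thesis using r by blast
qed

end
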